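(* Let $\alpha\in(0,2)$, $a>0$, and let $\sigma:\mathbb{R}^2\times[0,\infty)\to\mathbb{R}$ be continuous and bounded, and suppose there is $\gamma\in(0,1]$ such that $|\sigma(x,t)-\sigma(x,s)|\le|t-s|^\gamma$ for all $t,s\ge0$, $x\in\mathbb{R}^2$. Let \[ U(x,t)=C_\alpha\sum_{k\ge1}\Gamma_k^{-1/\alpha}\varphi(\xi_k)^{-1/\alpha}G(x,\xi_k,t)g_k \] be the LePage-series realization of $\iint_{\mathbb{R}^2}G(x,y,t)M(dy)$. Then for any $T>0$ and $x\in\mathbb{R}^2$, the function $t\mapsto U(x,t)$ is almost surely Hölder continuous on $[0,T]$ with any exponent less than $\gamma\wedge\frac12$.
   Context: Define, for $x,y\in\mathbb{R}^2$, $t\ge0$, \[ G(x,y,t)=\frac{1}{2\pi a}\int_0^{t-\frac{|x-y|}{a}}\frac{\sigma(y,\tau)}{\sqrt{a^2(t-\tau)^2-|y-x|^2}}\,d\tau\;\mathbf{1}_{\{|x-y|<at\}}. \] LePage construction: $\varphi$ is a continuous, everywhere positive probability density on $\mathbb{R}^2$; $\{\Gamma_k\}$ are arrival times of a unit-intensity Poisson process, $\{\xi_k\}$ i.i.d. in $\mathbb{R}^2$ with density $\varphi$, $\{g_k\}$ i.i.d. centered Gaussian with $E|g_k|^\alpha=1$, the three families mutually independent; $C_\alpha=\big(\frac{\Gamma(2-\alpha)\cos(\pi\alpha/2)}{1-\alpha}\big)^{1/\alpha}$. The measure $M(A)=C_\alpha\sum_k\Gamma_k^{-1/\alpha}\varphi(\xi_k)^{-1/\alpha}\mathbf{1}_A(\xi_k)g_k$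 is an independently scattered symmetric $\alpha$-stable random measure on $\mathbb{R}^2$ with Lebesgue control measure; $U(x,t)$ is the candidate solution (Poisson's formula) of $\big(\frac{\partial^2}{\partial t^2}-a^2\Delta\big)U=\sigma\dot M$ with zero initial conditions. *)

theory Defs
  imports "HOL-Analysis.Analysis" "HOL-Probability.Probability"
begin

text \<open>Kernel G(x,y,t) of Poisson's formula for the 2D wave equation.
  The integral is the Lebesgue integral over [0, t - |x-y|/a].\<close>
definition Gker :: "real \<Rightarrow> (real^2 \<Rightarrow> real \<Rightarrow> real) \<Rightarrow> real^2 \<Rightarrow> real^2 \<Rightarrow> real \<Rightarrow> real" where
  "Gker a \<sigma> x y t =
     (if dist x y < a * t then
        1 / (2 * pi * a) *
        (LBINT \<tau>:{0..t - dist x y / a}. \<sigma> y \<tau> / sqrt (a\<^sup>2 * (t - \<tau>)\<^sup>2 - (dist y x)\<^sup>2))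
      else 0)"

text \<open>The constant C_alpha; at alpha = 1 the formula is read as its continuous
  extension (Gamma(1) * lim cos(pi a/2)/(1-a) = pi/2).\<close>
definition C_alpha :: "real \<Rightarrow> real" where
  "C_alpha \<alpha> = (if \<alpha> = 1 then pi / 2
     else (Gamma (2 - \<alpha>) * cos (pi * \<alpha> / 2) / (1 - \<alpha>)) powr (1 / \<alpha>))"

text \<open>k-th term (k = 0,1,2,... corresponds to k = 1,2,3,... in the paper) of the LePage series.\<close>
definition lepage_term ::
  "real \<Rightarrow> real \<Rightarrow> (real^2 \<Rightarrow> real \<Rightarrow> real) \<Rightarrow> (real^2 \<Rightarrow> real)
    \<Rightarrow> (nat \<Rightarrow> 'w \<Rightarrow> real) \<Rightarrow> (nat \<Rightarrow> 'w \<Rightarrow> real^2) \<Rightarrow> (nat \<Rightarrow> 'w \<Rightarrow> real)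
    \<Rightarrow> real^2 \<Rightarrow> real \<Rightarrow> 'w \<Rightarrow> nat \<Rightarrow> real" where
  "lepage_term \<alpha> a \<sigma> \<phi> \<Gamma>\<^sub>k \<xi> g x t \<omega> k =
     C_alpha \<alpha> * \<Gamma>\<^sub>k k \<omega> powr (-1 / \<alpha>) * \<phi> (\<xi> k \<omega>) powr (-1 / \<alpha>) * Gker a \<sigma> x (\<xi> k \<omega>) t * g k \<omega>"

definition lepage_U ::
  "real \<Rightarrow> real \<Rightarrow> (real^2 \<Rightarrow> real \<Rightarrow> real) \<Rightarrow> (real^2 \<Rightarrow> real)
    \<Rightarrow> (nat \<Rightarrow> 'w \<Rightarrow> real) \<Rightarrow> (nat \<Rightarrow> 'w \<Rightarrow> real^2) \<Rightarrow> (nat \<Rightarrow> 'w \<Rightarrow> real)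
    \<Rightarrow> real^2 \<Rightarrow> real \<Rightarrow> 'w \<Rightarrow> real" where
  "lepage_U \<alpha> a \<sigma> \<phi> \<Gamma>\<^sub>k \<xi> g x t \<omega> = (\<Sum>k. lepage_term \<alpha> a \<sigma> \<phi> \<Gamma>\<^sub>k \<xi> g x t \<omega> k)"

definition seq_sigma :: "'w measure \<Rightarrow> (nat \<Rightarrow> 'w \<Rightarrow> 'b::topological_space) \<Rightarrow> 'w set set" where
  "seq_sigma M X = sigma_sets (space M) (\<Union>k. {X k -` A \<inter> space M | A. A \<in> sets borel})"

datatype lepage_family = FamGamma | FamXi | FamG

end

theory Submission
  imports Defs
begin

text \<open>
  Conditionally on the points \<open>(\<Gamma>\<^sub>k, \<xi>\<^sub>k)\<close> the series is Gaussian. The substitution \<open>v = t - \<tau>\<close> in the kernel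
  gives \<open>|G(x,y,t) - G(x,y,u)| \<le> K |x-y|^(-1/2) |t-u|^\<eta>\<close> on \<open>[0,T]\<close> with \<open>\<eta> = min \<gamma> (1/2)\<close>, and
  \<open>1 / |x-y|\<close> is locally integrable in the plane. Since \<open>\<Gamma>\<^sub>k\<close> grows linearly and \<open>2/\<alpha> > 1\<close>, the squared
  Hoelder constants of the coefficients are almost surely summable even against a weight
  \<open>(k+1)^(2\<delta>)\<close>, \<open>\<delta> > 0\<close>.

  This room to spare replaces a maximal inequality for the partial sums. For the series with weights
  \<open>(k+1)^\<delta>\<close>, all even moments of the increments of the partial sums \<open>B n\<close> are bounded uniformly in
  \<open>n\<close>, so summing the \<open>2q\<close>-th moments of all dyadic increments over all \<open>n\<close> against \<open>1/(n+1)^2\<close> shows that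
  the \<open>B n\<close> are Hoelder continuous with constants \<open>O((n+1)^(1/q))\<close>. For large \<open>q\<close>, summation by parts
  gives convergence of the unweighted series for all times at once, with the same modulus of continuity.
\<close>

section \<open>Hoelder continuity from dyadic increments\<close>

lemma powr_le_powr_smaller_exponent:
  fixes d :: real
  assumes "0 \<le> d" "d \<le> T" "p \<le> p'"
  shows "d powr p' \<le> T powr (p' - p) * d powr p"
proof (cases "d = 0")
  case False
  have "d powr p' = d powr (p' - p) * d powr p" by (simp add: powr_add[symmetric])
  also have "\<dots> \<le> T powr (p' - p) * d powr p"
    using assms by (intro mult_right_mono powr_mono2) auto
  finally show ?thesis .
qed simp

lemma continuous_on_of_hoelder:
  fixes f :: "real \<Rightarrow> real"
  assumes \<eta>: "0 < \<eta>" and f: "\<And>t u. t \<in> S \<Longrightarrow> u \<in> S \<Longrightarrow> \<bar>f t - f u\<bar> \<le> C * \<bar>t - u\<bar> powr \<eta>"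
  shows "continuous_on S f"
  unfolding continuous_on_def
proof
  fix u assume u: "u \<in> S"
  have "((\<lambda>t. \<bar>t - u\<bar>) \<longlongrightarrow> \<bar>u - u\<bar>) (at u within S)" by (intro tendsto_intros)
  then have "((\<lambda>t. \<bar>t - u\<bar> powr \<eta>) \<longlongrightarrow> 0) (at u within S)"
    using \<eta> by (intro tendsto_zero_powrI[where b = \<eta>]) auto
  then have "((\<lambda>t. C * \<bar>t - u\<bar> powr \<eta>) \<longlongrightarrow> 0) (at u within S)"
    by (rule tendsto_mult_right_zero)
  moreover have "\<forall>\<^sub>F t in at u within S. norm (f t - f u) \<le> C * \<bar>t - u\<bar> powr \<eta>"
    using f u by (auto simp: eventually_at_filter intro!: always_eventually)
  ultimately have "((\<lambda>t. f t - f u) \<longlongrightarrow> 0) (at u within S)"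
    by (rule Lim_null_comparison[rotated])
  then show "(f \<longlongrightarrow> f u) (at u within S)" by (rule LIM_zero_cancel)
qed

lemma dyadic_floor_tendsto:
  fixes t :: real
  assumes "0 \<le> t"
  shows "(\<lambda>j. real (nat \<lfloor>2 ^ j * t\<rfloor>) / 2 ^ j) \<longlonglongrightarrow> t"
proof -
  have bound: "norm (real (nat \<lfloor>2 ^ j * t\<rfloor>) / 2 ^ j - t) \<le> (1 / 2) ^ j" for j
  proof -
    have "\<bar>real (nat \<lfloor>2 ^ j * t\<rfloor>) - 2 ^ j * t\<bar> \<le> 1"
      using assms by (simp add: of_nat_nat abs_le_iff) linarith
    moreover have "real (nat \<lfloor>2 ^ j * t\<rfloor>) / 2 ^ j - t = (real (nat \<lfloor>2 ^ j * t\<rfloor>) - 2 ^ j * t) / 2 ^ j"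
      by (simp add: field_simps)
    ultimately show ?thesis
      by (simp add: abs_divide power_one_over divide_right_mono)
  qed
  have "(\<lambda>j. (1 / 2 :: real) ^ j) \<longlonglongrightarrow> 0"
    by (rule LIMSEQ_power_zero) simp
  then have "(\<lambda>j. real (nat \<lfloor>2 ^ j * t\<rfloor>) / 2 ^ j - t) \<longlonglongrightarrow> 0"
    by (rule Lim_null_comparison[OF always_eventually[OF allI[OF bound]]])
  then show ?thesis
    by (rule LIM_zero_cancel)
qed

text \<open>Deterministic chaining. The dyadic truncations \<open>p j r\<close> converge to
  \<open>r\<close> and move by at most one cell per level, so \<open>f r - f (p j r)\<close> is
  bounded by a geometric tail; at the level whose mesh matches \<open>t - u\<close>, the truncations
  of the two times are equal or adjacent. The constant is explicit and linear in \<open>K\<close>,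
  because \<open>K\<close> will later depend on the number of summands.\<close>

lemma hoelder_of_dyadic_increments_unit:
  fixes f :: "real \<Rightarrow> real"
  assumes \<beta>: "0 < \<beta>" and K: "0 \<le> K" and cont: "continuous_on {0..1} f"
    and incr: "\<And>i l. l < 2 ^ i \<Longrightarrow>
      \<bar>f (real (Suc l) / 2 ^ i) - f (real l / 2 ^ i)\<bar> \<le> K * (2 powr -\<beta>) ^ i"
    and u: "0 \<le> u" and ut: "u < t" and t: "t \<le> 1"
  shows "\<bar>f t - f u\<bar> \<le> K * ((1 + 2 powr -\<beta>) / (1 - 2 powr -\<beta>) * 2 powr \<beta>) * \<bar>t - u\<bar> powr \<beta>"
proof -
  define \<rho> where "\<rho> = 2 powr -\<beta>"
  have "\<rho> < 2 powr 0" unfolding \<rho>_def using \<beta> by (intro powr_less_mono) auto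
  then have \<rho>: "0 < \<rho>" "\<rho> < 1" by (auto simp: \<rho>_def)
  define N where "N j r = nat \<lfloor>2 ^ j * r\<rfloor>" for j :: nat and r :: real
  define p where "p j r = real (N j r) / 2 ^ j" for j r
  have approx: "\<bar>f r - f (p j r)\<bar> \<le> K * (\<rho> ^ Suc j / (1 - \<rho>))" if r: "0 \<le> r" "r \<le> 1" for r j
  proof -
    have N_le: "N i r \<le> 2 ^ i" for i
    proof -
      have "2 ^ i * r \<le> 2 ^ i" using r by (simp add: mult_left_le)
      then have "real_of_int \<lfloor>2 ^ i * r\<rfloor> \<le> real_of_int (2 ^ i)"
        using of_int_floor_le[of "2 ^ i * r"] by (simp only: of_int_power of_int_numeral)
      then have "\<lfloor>2 ^ i * r\<rfloor> \<le> 2 ^ i" by (simp only: of_int_le_iff)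
      then show ?thesis unfolding N_def by (simp add: nat_le_iff)
    qed
    \<comment> \<open>Passing to the next level appends one binary digit: the truncation either
      stays or moves by one cell of the finer grid.\<close>
    have step: "\<bar>f (p (Suc i) r) - f (p i r)\<bar> \<le> K * \<rho> ^ Suc i" for i
    proof -
      have "N (Suc i) r = 2 * N i r \<or> N (Suc i) r = Suc (2 * N i r)"
      proof -
        have "0 \<le> \<lfloor>2 ^ i * r\<rfloor>" using r by simp
        moreover have "\<lfloor>2 ^ Suc i * r\<rfloor> = 2 * \<lfloor>2 ^ i * r\<rfloor> \<or> \<lfloor>2 ^ Suc i * r\<rfloor> = 2 * \<lfloor>2 ^ i * r\<rfloor> + 1"
          by simp linarith
        moreover have "nat y = 2 * nat z \<or> nat y = Suc (2 * nat z)"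
          if "0 \<le> z" "y = 2 * z \<or> y = 2 * z + 1" for y z :: int
          using that by auto
        ultimately show ?thesis unfolding N_def by blast
      qed
      then show ?thesis
      proof
        assume "N (Suc i) r = 2 * N i r"
        then have "p (Suc i) r = p i r" by (simp add: p_def)
        then show ?thesis using K \<rho> by simp
      next
        assume *: "N (Suc i) r = Suc (2 * N i r)"
        then have "2 * N i r < 2 ^ Suc i" using N_le[of "Suc i"] by simp
        from incr[OF this] have "\<bar>f (real (Suc (2 * N i r)) / 2 ^ Suc i) - f (real (2 * N i r) / 2 ^ Suc i)\<bar> \<le> K * \<rho> ^ Suc i"
          by (simp add: \<rho>_def)
        moreover have "real (2 * N i r) / 2 ^ Suc i = p i r" by (simp add: p_def)
        ultimately show ?thesis unfolding p_def[of "Suc i"] * by simp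
      qed
    qed
    \<comment> \<open>The right-hand side is the closed form of the sum of
      \<open>K * \<rho> ^ i\<close> over \<open>i\<close> from \<open>j + 1\<close> to
      \<open>j + m\<close>.\<close>
    have tel: "\<bar>f (p (j + m) r) - f (p j r)\<bar> \<le> K * (\<rho> ^ Suc j / (1 - \<rho>)) * (1 - \<rho> ^ m)" for m
    proof (induction m)
      case (Suc m)
      have "\<bar>f (p (j + Suc m) r) - f (p j r)\<bar> \<le> K * (\<rho> ^ Suc j / (1 - \<rho>)) * (1 - \<rho> ^ m) + K * \<rho> ^ Suc (j + m)"
        using Suc step[of "j + m"] by simp
      also have "\<dots> = K * (\<rho> ^ Suc j / (1 - \<rho>)) * (1 - \<rho> ^ Suc m)"
        using \<rho> by (simp add: field_simps power_add)
      finally show ?case .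
    qed simp
    have tel': "\<bar>f (p (j + m) r) - f (p j r)\<bar> \<le> K * (\<rho> ^ Suc j / (1 - \<rho>))" for m
    proof -
      have "K * (\<rho> ^ Suc j / (1 - \<rho>)) * (1 - \<rho> ^ m) \<le> K * (\<rho> ^ Suc j / (1 - \<rho>)) * 1"
        using K \<rho> by (intro mult_left_mono) auto
      then show ?thesis using tel[of m] by simp
    qed
    have "(\<lambda>m. p m r) \<longlonglongrightarrow> r"
      unfolding p_def N_def using r by (intro dyadic_floor_tendsto)
    then have "(\<lambda>m. p (m + j) r) \<longlonglongrightarrow> r" by (rule LIMSEQ_ignore_initial_segment)
    then have "(\<lambda>m. p (j + m) r) \<longlonglongrightarrow> r" by (simp add: add.commute)
    moreover have "p m r \<in> {0..1}" for m
      using N_le[of m] of_nat_mono[OF N_le[of m], where 'a = real] by (simp add: p_def)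
    ultimately have "(\<lambda>m. f (p (j + m) r)) \<longlonglongrightarrow> f r"
      using cont r by (intro continuous_on_tendsto_compose[OF cont]) auto
    then have "(\<lambda>m. \<bar>f (p (j + m) r) - f (p j r)\<bar>) \<longlonglongrightarrow> \<bar>f r - f (p j r)\<bar>"
      by (intro tendsto_intros)
    then show ?thesis
      by (rule LIMSEQ_le_const2) (use tel' in auto)
  qed
  define h where "h = t - u"
  have h: "0 < h" "h \<le> 1" using u ut t by (auto simp: h_def)
  \<comment> \<open>\<open>Suc j\<close> is the least level with mesh below \<open>h\<close>. It is
    not level 0 because \<open>h \<le> 1\<close>, so level \<open>j\<close> exists and its mesh is
    still at least \<open>h\<close>.\<close>
  obtain j where j: "1 / 2 ^ Suc j < h" "h \<le> 1 / 2 ^ j"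
  proof -
    have "\<exists>n. (1 / 2) ^ n < h" using h by (intro real_arch_pow_inv) auto
    then have ex: "\<exists>n. 1 / 2 ^ n < h" by (simp add: power_one_over)
    define n where "n = (LEAST n. 1 / 2 ^ n < h)"
    have n: "1 / 2 ^ n < h" unfolding n_def by (rule LeastI_ex[OF ex])
    then have "n \<noteq> 0" using h by (intro notI) simp
    then obtain j where "n = Suc j" by (cases n) auto
    moreover have "\<not> 1 / 2 ^ j < h" using not_less_Least[of j "\<lambda>n. 1 / 2 ^ n < h"] \<open>n = Suc j\<close>
      by (simp add: n_def)
    ultimately show ?thesis using that n by auto
  qed
  have mid: "\<bar>f (p j t) - f (p j u)\<bar> \<le> K * \<rho> ^ j"
  proof -
    have "2 ^ j * t \<le> 2 ^ j * u + 1" using j(2) by (simp add: h_def field_simps)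
    moreover have "2 ^ j * u \<le> 2 ^ j * t" using ut by simp
    ultimately have "\<lfloor>2 ^ j * t\<rfloor> = \<lfloor>2 ^ j * u\<rfloor> \<or> \<lfloor>2 ^ j * t\<rfloor> = \<lfloor>2 ^ j * u\<rfloor> + 1"
      by linarith
    moreover have "0 \<le> \<lfloor>2 ^ j * u\<rfloor>" using u by simp
    moreover have "nat y = nat z \<or> nat y = Suc (nat z)"
      if "0 \<le> z" "y = z \<or> y = z + 1" for y z :: int
      using that by auto
    ultimately have "N j t = N j u \<or> N j t = Suc (N j u)" unfolding N_def by blast
    then show ?thesis
    proof
      assume "N j t = N j u"
      then show ?thesis using K \<rho> by (simp add: p_def)
    next
      assume *: "N j t = Suc (N j u)"
      have "2 ^ j * t \<le> 2 ^ j" using t by simp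
      then have "real_of_int \<lfloor>2 ^ j * t\<rfloor> \<le> real_of_int (2 ^ j)"
        using of_int_floor_le[of "2 ^ j * t"] by (simp only: of_int_power of_int_numeral)
      then have "\<lfloor>2 ^ j * t\<rfloor> \<le> 2 ^ j" by (simp only: of_int_le_iff)
      then have "N j t \<le> 2 ^ j" unfolding N_def by (simp add: nat_le_iff)
      then have "N j u < 2 ^ j" using * by simp
      from incr[OF this] show ?thesis by (simp add: p_def * \<rho>_def)
    qed
  qed
  have "\<bar>f t - f u\<bar> \<le> \<bar>f t - f (p j t)\<bar> + \<bar>f (p j t) - f (p j u)\<bar> + \<bar>f u - f (p j u)\<bar>"
    by linarith
  also have "\<dots> \<le> K * (\<rho> ^ Suc j / (1 - \<rho>)) + K * \<rho> ^ j + K * (\<rho> ^ Suc j / (1 - \<rho>))"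
    using approx[of t j] approx[of u j] mid u ut t by (intro add_mono) auto
  also have "\<dots> = K * (\<rho> / (1 - \<rho>) + 1 + \<rho> / (1 - \<rho>)) * \<rho> ^ j"
    by (simp add: algebra_simps)
  also have "\<rho> / (1 - \<rho>) + 1 + \<rho> / (1 - \<rho>) = (1 + \<rho>) / (1 - \<rho>)"
    using \<rho> by (simp add: field_simps)
  finally have *: "\<bar>f t - f u\<bar> \<le> K * ((1 + \<rho>) / (1 - \<rho>)) * \<rho> ^ j" .
  \<comment> \<open>The choice of \<open>j\<close> bounds the mesh by \<open>2 * h\<close>, which is
    where the factor \<open>2 powr \<beta>\<close> comes from.\<close>
  have "\<rho> ^ j \<le> 2 powr \<beta> * h powr \<beta>"
  proof -
    have "\<rho> ^ j = (1 / 2 ^ j) powr \<beta>"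
      by (simp add: \<rho>_def powr_minus powr_divide inverse_eq_divide power_one_over powr_realpow[symmetric] powr_powr mult.commute)
    also have "\<dots> \<le> (2 * h) powr \<beta>"
      using j \<beta> by (intro powr_mono2) (auto simp: field_simps)
    also have "\<dots> = 2 powr \<beta> * h powr \<beta>" using h by (simp add: powr_mult)
    finally show ?thesis .
  qed
  then have "K * ((1 + \<rho>) / (1 - \<rho>)) * \<rho> ^ j \<le> K * ((1 + \<rho>) / (1 - \<rho>)) * (2 powr \<beta> * h powr \<beta>)"
    using K \<rho> by (intro mult_left_mono) auto
  with * show ?thesis
    using ut by (simp add: \<rho>_def h_def mult.assoc)
qed

lemma hoelder_of_dyadic_increments:
  fixes f :: "real \<Rightarrow> real"
  assumes T: "0 < T" and \<beta>: "0 < \<beta>" and K: "0 \<le> K" and cont: "continuous_on {0..T} f"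
    and incr: "\<And>i l. l < 2 ^ i \<Longrightarrow>
      \<bar>f (T * real (Suc l) / 2 ^ i) - f (T * real l / 2 ^ i)\<bar> \<le> K * (2 powr -\<beta>) ^ i"
    and t: "t \<in> {0..T}" and u: "u \<in> {0..T}"
  shows "\<bar>f t - f u\<bar> \<le> K * ((1 + 2 powr -\<beta>) / (1 - 2 powr -\<beta>) * (2 / T) powr \<beta>) * \<bar>t - u\<bar> powr \<beta>"
proof -
  define F where "F r = f (T * r)" for r
  have cont_F: "continuous_on {0..1} F"
    unfolding F_def using T by (intro continuous_on_compose2[OF cont] continuous_intros) (auto simp: mult_left_le)
  have incr_F: "\<bar>F (real (Suc l) / 2 ^ i) - F (real l / 2 ^ i)\<bar> \<le> K * (2 powr -\<beta>) ^ i"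
    if "l < 2 ^ i" for i l
    using incr[OF that] by (simp add: F_def)
  have less: "\<bar>f t - f u\<bar> \<le> K * ((1 + 2 powr -\<beta>) / (1 - 2 powr -\<beta>) * (2 / T) powr \<beta>) * \<bar>t - u\<bar> powr \<beta>"
    if "u < t" "u \<in> {0..T}" "t \<in> {0..T}" for t u
  proof -
    have "\<bar>F (t / T) - F (u / T)\<bar> \<le>
      K * ((1 + 2 powr -\<beta>) / (1 - 2 powr -\<beta>) * 2 powr \<beta>) * \<bar>t / T - u / T\<bar> powr \<beta>"
      using that T
      by (intro hoelder_of_dyadic_increments_unit[OF \<beta> K cont_F incr_F]) (auto simp: divide_strict_right_mono)
    also have "\<bar>t / T - u / T\<bar> powr \<beta> = \<bar>t - u\<bar> powr \<beta> / T powr \<beta>"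
      using T by (simp add: powr_divide flip: diff_divide_distrib)
    finally show ?thesis using T by (simp add: F_def powr_divide)
  qed
  consider "u < t" | "t < u" | "t = u" by linarith
  then show ?thesis
    using less[of u t] less[of t u] t u by cases (auto simp: abs_minus_commute)
qed

text \<open>In the summation by parts, \<open>(k+1)^(-\<delta>)\<close> is the square of \<open>w k = (k+1)^(-\<delta>/2)\<close>, so that its
  differences times the growth rate \<open>1 / w (k+1)\<close> are at most \<open>3 (w k - w (k+1))\<close>, which telescopes.\<close>
lemma weighted_sums_of_slowly_growing_partial_sums:
  fixes b :: "nat \<Rightarrow> real"
  assumes \<delta>: "0 < \<delta>" "\<delta> \<le> 2"
    and B: "\<And>n. \<bar>\<Sum>k<n. b k\<bar> \<le> K * real (Suc n) powr (\<delta> / 2)"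
  shows "summable (\<lambda>k. real (Suc k) powr -\<delta> * b k)"
    and "\<bar>\<Sum>k. real (Suc k) powr -\<delta> * b k\<bar> \<le> 3 * K"
proof -
  define w where "w k = real (Suc k) powr (- \<delta> / 2)" for k
  define S where "S n = (\<Sum>k<n. b k)" for n
  define e where "e k = ((w k)\<^sup>2 - (w (Suc k))\<^sup>2) * S (Suc k)" for k
  have K: "0 \<le> K" using order_trans[OF abs_ge_zero B[of 0]] by simp
  have w2: "real (Suc k) powr -\<delta> = (w k)\<^sup>2" for k
    by (simp add: w_def power2_eq_square powr_add[symmetric])
  have w_pos: "0 < w k" for k by (simp add: w_def)
  have w_dec: "w (Suc k) \<le> w k" for k
    unfolding w_def using \<delta> by (intro powr_mono2') auto
  have S_le: "\<bar>S n\<bar> \<le> K / w n" for n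
    using B[of n] by (simp add: S_def w_def powr_minus field_simps)
  have parts: "(\<Sum>k<n. (w k)\<^sup>2 * b k) = (w n)\<^sup>2 * S n + (\<Sum>k<n. e k)" for n
    by (induction n) (simp_all add: S_def e_def algebra_simps)
  have w0: "w \<longlonglongrightarrow> 0"
    unfolding w_def using \<delta>
    by (intro tendsto_neg_powr filterlim_compose[OF filterlim_real_sequentially] filterlim_Suc) auto
  \<comment> \<open>The ratio of consecutive weights is at most
    \<open>2 powr (\<delta> / 2)\<close>, hence at most 2 because \<open>\<delta> \<le> 2\<close>.
    This gives \<open>w k + w (Suc k) \<le> 3 * w (Suc k)\<close>, the origin of the factor
    3.\<close>
  have w_quot: "w k \<le> 2 * w (Suc k)" for k
  proof -
    have "real (Suc (Suc k)) powr (\<delta> / 2) \<le> (2 * real (Suc k)) powr (\<delta> / 2)"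
      using \<delta> by (intro powr_mono2) auto
    also have "\<dots> = 2 powr (\<delta> / 2) * real (Suc k) powr (\<delta> / 2)" by (rule powr_mult)
    also have "\<dots> \<le> 2 powr 1 * real (Suc k) powr (\<delta> / 2)"
      using \<delta> by (intro mult_right_mono powr_mono) auto
    finally show ?thesis by (simp add: w_def powr_minus field_simps)
  qed
  have e_le: "norm (e k) \<le> 3 * K * (w k - w (Suc k))" for k
  proof -
    have "norm (e k) = (w k - w (Suc k)) * (w k + w (Suc k)) * \<bar>S (Suc k)\<bar>"
      using w_dec[of k] w_pos[of k] w_pos[of "Suc k"]
      by (simp add: e_def abs_mult power2_eq_square square_diff_square_factored)
    also have "\<dots> \<le> (w k - w (Suc k)) * (3 * w (Suc k)) * (K / w (Suc k))"
      using w_dec[of k] w_pos[of k] w_pos[of "Suc k"] S_le w_quot[of k]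
      by (intro mult_mono) auto
    also have "\<dots> = 3 * K * (w k - w (Suc k))" using w_pos[of "Suc k"] by simp
    finally show ?thesis .
  qed
  have "(\<lambda>k. w k - w (Suc k)) sums (w 0 - 0)" using w0 by (rule telescope_sums')
  then have tel: "(\<lambda>k. 3 * K * (w k - w (Suc k))) sums (3 * K)"
    using sums_mult[of _ _ "3 * K"] by (fastforce simp: w_def)
  have e_sum: "summable (\<lambda>k. norm (e k))"
    by (rule summable_comparison_test'[OF sums_summable[OF tel]]) (use e_le in auto)
  have "norm (suminf e) \<le> (\<Sum>k. norm (e k))" by (rule summable_norm[OF e_sum])
  also have "\<dots> \<le> (\<Sum>k. 3 * K * (w k - w (Suc k)))"
    by (intro suminf_le e_le e_sum sums_summable[OF tel])
  finally have e_bound: "\<bar>suminf e\<bar> \<le> 3 * K" using sums_unique[OF tel] by simp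
  have "(\<lambda>n. (w n)\<^sup>2 * S n) \<longlonglongrightarrow> 0"
  proof (rule Lim_null_comparison)
    show "(\<lambda>n. K * w n) \<longlonglongrightarrow> 0" using w0 by (auto intro: tendsto_mult_right_zero)
    show "\<forall>\<^sub>F n in sequentially. norm ((w n)\<^sup>2 * S n) \<le> K * w n"
    proof (intro always_eventually allI)
      fix n
      have "(w n)\<^sup>2 * \<bar>S n\<bar> \<le> (w n)\<^sup>2 * (K / w n)" using S_le by (intro mult_left_mono) auto
      then show "norm ((w n)\<^sup>2 * S n) \<le> K * w n"
        using w_pos[of n] by (simp add: abs_mult power2_eq_square)
    qed
  qed
  moreover have "(\<lambda>n. \<Sum>k<n. e k) \<longlonglongrightarrow> suminf e"
    using summable_norm_cancel[OF e_sum] by (simp add: summable_LIMSEQ)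
  ultimately have "(\<lambda>n. \<Sum>k<n. (w k)\<^sup>2 * b k) \<longlonglongrightarrow> 0 + suminf e"
    unfolding parts by (rule tendsto_add)
  then have "(\<lambda>k. real (Suc k) powr -\<delta> * b k) sums suminf e"
    unfolding sums_def w2 by simp
  then show "summable (\<lambda>k. real (Suc k) powr -\<delta> * b k)"
    and "\<bar>\<Sum>k. real (Suc k) powr -\<delta> * b k\<bar> \<le> 3 * K"
    using e_bound by (auto simp: sums_iff)
qed

section \<open>Gaussian series with independent random coefficients\<close>

lemma ennreal_le_suminf: "f i \<le> suminf f" for f :: "nat \<Rightarrow> ennreal"
  using sum_le_suminf[of f "{i}"] by simp

text \<open>Takes the place of conditioning on \<open>F\<close>. The identity, read once as a map
  into \<open>F\<close> and once as a map into \<open>H\<close>, yields two independent random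
  variables whose joint law is that of the diagonal \<open>(\<omega>, \<omega>)\<close>; so this law
  is a product and Tonelli applies.\<close>

lemma (in prob_space) nn_integral_indep_subalgebras:
  assumes F: "subalgebra M F" and H: "subalgebra M H"
    and indep: "indep_set (sets F) (sets H)"
    and f: "f \<in> borel_measurable (F \<Otimes>\<^sub>M H)"
  shows "(\<integral>\<^sup>+\<omega>. f (\<omega>, \<omega>) \<partial>M) = (\<integral>\<^sup>+\<omega>. \<integral>\<^sup>+\<omega>'. f (\<omega>, \<omega>') \<partial>M \<partial>M)"
proof -
  have [simp]: "space F = space M" "space H = space M"
    using F H by (auto simp: subalgebra_def)
  have mF [measurable]: "(\<lambda>\<omega>. \<omega>) \<in> measurable M F"
    by (rule measurable_from_subalg[OF F]) simp
  have mH [measurable]: "(\<lambda>\<omega>. \<omega>) \<in> measurable M H"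
    by (rule measurable_from_subalg[OF H]) simp
  note f[measurable]
  have vimage: "sigma_sets (space M) {(\<lambda>\<omega>. \<omega>) -` A \<inter> space M |A. A \<in> sets N} = sets N"
    if "space N = space M" for N
  proof -
    have "{(\<lambda>\<omega>. \<omega>) -` A \<inter> space M |A. A \<in> sets N} = sets N"
      using sets.sets_into_space[of _ N] that by (auto simp: Int_absorb2)
    then show ?thesis
      using sets.sigma_sets_eq[of N] that by simp
  qed
  have "indep_var F (\<lambda>\<omega>. \<omega>) H (\<lambda>\<omega>. \<omega>)"
    unfolding indep_var_eq vimage[OF \<open>space F = space M\<close>] vimage[OF \<open>space H = space M\<close>]
    using indep mF mH by blast
  then have distr: "distr M F (\<lambda>\<omega>. \<omega>) \<Otimes>\<^sub>M distr M H (\<lambda>\<omega>. \<omega>) = distr M (F \<Otimes>\<^sub>M H) (\<lambda>\<omega>. (\<omega>, \<omega>))"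
    by (simp add: indep_var_distribution_eq)
  interpret PH: prob_space "distr M H (\<lambda>\<omega>. \<omega>)"
    by (rule prob_space_distr[OF mH])
  have "(\<integral>\<^sup>+\<omega>. f (\<omega>, \<omega>) \<partial>M) = integral\<^sup>N (distr M (F \<Otimes>\<^sub>M H) (\<lambda>\<omega>. (\<omega>, \<omega>))) f"
    by (simp add: nn_integral_distr)
  also have "\<dots> = (\<integral>\<^sup>+\<omega>. \<integral>\<^sup>+\<omega>'. f (\<omega>, \<omega>') \<partial>distr M H (\<lambda>\<omega>. \<omega>) \<partial>distr M F (\<lambda>\<omega>. \<omega>))"
    unfolding distr[symmetric] by (rule PH.nn_integral_fst[symmetric]) simp
  also have "\<dots> = (\<integral>\<^sup>+\<omega>. \<integral>\<^sup>+\<omega>'. f (\<omega>, \<omega>') \<partial>distr M H (\<lambda>\<omega>. \<omega>) \<partial>M)"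
    by (subst nn_integral_distr[OF mF]) (auto intro!: PH.borel_measurable_nn_integral_fst)
  also have "\<dots> = (\<integral>\<^sup>+\<omega>. \<integral>\<^sup>+\<omega>'. f (\<omega>, \<omega>') \<partial>M \<partial>M)"
    by (intro nn_integral_cong nn_integral_distr[OF mH]) (auto intro!: measurable_Pair2[OF f])
  finally show ?thesis .
qed

text \<open>This is the double factorial (2q - 1)!!, the moment of order 2q of a standard normal
  variable.\<close>

definition gaussian_moment_constant :: "nat \<Rightarrow> real" where
  "gaussian_moment_constant q = fact (2 * q) / (2 ^ q * fact q)"

text \<open>The sum is again centred Gaussian, so its moments depend on the coefficients only
  through its variance. Hence one bound on the sum of squares controls every even moment.\<close>

lemma (in prob_space) nn_integral_gaussian_sum_moment:
  fixes d :: "nat \<Rightarrow> real"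
  assumes s: "0 < s"
    and indep: "indep_vars (\<lambda>_. borel) g UNIV"
    and gauss: "\<And>k. distributed M lborel (g k) (\<lambda>r. ennreal (normal_density 0 s r))"
    and q: "0 < q"
  shows "(\<integral>\<^sup>+\<omega>. ennreal ((\<Sum>k<n. d k * g k \<omega>) ^ (2 * q)) \<partial>M) =
    ennreal (gaussian_moment_constant q * s ^ (2 * q) * (\<Sum>k<n. (d k)\<^sup>2) ^ q)"
proof -
  \<comment> \<open>Zero coefficients are discarded because a degenerate normal variable has no
    density. If none are left, both sides vanish since \<open>0 < q\<close>.\<close>
  define I where "I = {k. k < n \<and> d k \<noteq> 0}"
  have I: "finite I" "I \<subseteq> {..<n}" by (auto simp: I_def)
  have sum_I: "(\<Sum>k<n. d k * g k \<omega>) = (\<Sum>k\<in>I. d k * g k \<omega>)" for \<omega>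
    using I by (intro sum.mono_neutral_right) (auto simp: I_def)
  have sum_I2: "(\<Sum>k<n. (d k)\<^sup>2) = (\<Sum>k\<in>I. (d k)\<^sup>2)"
    using I by (intro sum.mono_neutral_right) (auto simp: I_def)
  show ?thesis
  proof (cases "I = {}")
    case True
    then show ?thesis using q by (simp add: sum_I sum_I2 zero_power)
  next
    case False
    define v where "v = (\<Sum>k\<in>I. (\<bar>d k\<bar> * s)\<^sup>2)"
    have v: "v = s\<^sup>2 * (\<Sum>k\<in>I. (d k)\<^sup>2)"
      by (simp add: v_def power_mult_distrib sum_distrib_left mult.commute)
    have "0 < v"
      unfolding v_def using False I s by (intro sum_pos) (auto simp: I_def)
    have dist: "distributed M lborel (\<lambda>\<omega>. d k * g k \<omega>) (normal_density 0 (\<bar>d k\<bar> * s))" if "k \<in> I" for k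
      using normal_density_affine[OF gauss s, of "d k" 0 k] that by (simp add: I_def)
    have "indep_vars (\<lambda>_. borel) (\<lambda>k \<omega>. d k * g k \<omega>) I"
      by (rule indep_vars_compose2[OF indep_vars_subset[OF indep]]) auto
    from sum_indep_normal[OF I(1) False this _ dist]
    have "distributed M lborel (\<lambda>\<omega>. \<Sum>k\<in>I. d k * g k \<omega>) (normal_density 0 (sqrt v))"
      using s by (simp add: v_def I_def)
    from distributed_nn_integral[OF this, of "\<lambda>x. ennreal (x ^ (2 * q))"]
    have "(\<integral>\<^sup>+\<omega>. ennreal ((\<Sum>k\<in>I. d k * g k \<omega>) ^ (2 * q)) \<partial>M) =
        (\<integral>\<^sup>+x. ennreal (normal_density 0 (sqrt v) x * x ^ (2 * q)) \<partial>lborel)"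
      by (simp add: ennreal_mult)
    also have "\<dots> = ennreal (fact (2 * q) / ((2 / (sqrt v)\<^sup>2) ^ q * fact q))"
    proof -
      have "has_bochner_integral lborel (\<lambda>x. normal_density 0 (sqrt v) x * x ^ (2 * q))
          (fact (2 * q) / ((2 / (sqrt v)\<^sup>2) ^ q * fact q))"
        using normal_moment_even[of "sqrt v" 0 q] \<open>0 < v\<close> by simp
      then show ?thesis
        by (subst nn_integral_eq_integral) (auto simp: has_bochner_integral_iff)
    qed
    also have "\<dots> = ennreal (gaussian_moment_constant q * s ^ (2 * q) * (\<Sum>k\<in>I. (d k)\<^sup>2) ^ q)"
      using \<open>0 < v\<close> s
      by (simp add: gaussian_moment_constant_def power_divide v power_mult_distrib power_mult[symmetric] field_simps)
    finally show ?thesis by (simp only: sum_I sum_I2)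
  qed
qed

text \<open>The coefficients depend only on \<open>F\<close> and can be frozen while the Gaussian
  variables are integrated out. The event \<open>A\<close> permits a truncation: the random sum of
  squares need not have moments, but it can be bounded on suitable events of
  \<open>F\<close>.\<close>

lemma (in prob_space) nn_integral_gaussian_sum_moment_indep:
  fixes D :: "nat \<Rightarrow> 'a \<Rightarrow> real"
  assumes F: "subalgebra M F" and H: "subalgebra M H"
    and indep_FH: "indep_set (sets F) (sets H)"
    and g_H: "\<And>k. g k \<in> borel_measurable H"
    and D: "\<And>k. D k \<in> borel_measurable F" and A: "A \<in> sets F"
    and s: "0 < s"
    and indep: "indep_vars (\<lambda>_. borel) g UNIV"
    and gauss: "\<And>k. distributed M lborel (g k) (\<lambda>r. ennreal (normal_density 0 s r))"
    and q: "0 < q"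
  shows "(\<integral>\<^sup>+\<omega>. indicator A \<omega> * ennreal ((\<Sum>k<n. D k \<omega> * g k \<omega>) ^ (2 * q)) \<partial>M) =
    (\<integral>\<^sup>+\<omega>. indicator A \<omega> * ennreal (gaussian_moment_constant q * s ^ (2 * q) * (\<Sum>k<n. (D k \<omega>)\<^sup>2) ^ q) \<partial>M)"
proof -
  note g_H[measurable] D[measurable] A[measurable]
  have g_M: "g k \<in> borel_measurable M" for k
    by (rule measurable_from_subalg[OF H g_H])
  define f where "f = (\<lambda>(\<omega>, \<omega>'). indicator A \<omega> * ennreal ((\<Sum>k<n. D k \<omega> * g k \<omega>') ^ (2 * q)))"
  have "f \<in> borel_measurable (F \<Otimes>\<^sub>M H)" unfolding f_def by measurable
  from nn_integral_indep_subalgebras[OF F H indep_FH this]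
  have "(\<integral>\<^sup>+\<omega>. indicator A \<omega> * ennreal ((\<Sum>k<n. D k \<omega> * g k \<omega>) ^ (2 * q)) \<partial>M) =
      (\<integral>\<^sup>+\<omega>. \<integral>\<^sup>+\<omega>'. indicator A \<omega> * ennreal ((\<Sum>k<n. D k \<omega> * g k \<omega>') ^ (2 * q)) \<partial>M \<partial>M)"
    by (simp add: f_def)
  also have "\<dots> = (\<integral>\<^sup>+\<omega>. indicator A \<omega> * (\<integral>\<^sup>+\<omega>'. ennreal ((\<Sum>k<n. D k \<omega> * g k \<omega>') ^ (2 * q)) \<partial>M) \<partial>M)"
    using g_M by (intro nn_integral_cong nn_integral_cmult) auto
  finally show ?thesis
    by (simp add: nn_integral_gaussian_sum_moment[OF s indep gauss q])
qed

text \<open>The coefficients live in \<open>F\<close> and the Gaussian variables in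
  \<open>H\<close>, so the Gaussian moment formula applies conditionally. The summability in
  \<open>L_sum\<close> is only almost sure; moments are therefore taken on events where the sum is
  bounded, and these exhaust almost all of the space.\<close>

lemma (in prob_space) gaussian_series_hoelder:
  fixes c :: "nat \<Rightarrow> real \<Rightarrow> 'a \<Rightarrow> real" and L :: "nat \<Rightarrow> 'a \<Rightarrow> real"
  assumes F: "subalgebra M F" and H: "subalgebra M H"
    and indep_FH: "indep_set (sets F) (sets H)"
    and g_H: "\<And>k. g k \<in> borel_measurable H"
    and c_F: "\<And>k t. c k t \<in> borel_measurable F" and L_F: "\<And>k. L k \<in> borel_measurable F"
    and s: "0 < s"
    and indep: "indep_vars (\<lambda>_. borel) g UNIV"
    and gauss: "\<And>k. distributed M lborel (g k) (\<lambda>r. ennreal (normal_density 0 s r))"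
    and T: "0 < T" and \<delta>: "0 < \<delta>" "\<delta> \<le> 2" and \<beta>: "0 < \<beta>" "\<beta> < \<eta>"
    and c_0: "\<And>k \<omega>. c k 0 \<omega> = 0"
    and c_hoelder: "AE \<omega> in M. \<forall>k. \<forall>t\<in>{0..T}. \<forall>u\<in>{0..T}. \<bar>c k t \<omega> - c k u \<omega>\<bar> \<le> L k \<omega> * \<bar>t - u\<bar> powr \<eta>"
    and L_sum: "AE \<omega> in M. summable (\<lambda>k. real (Suc k) powr (2 * \<delta>) * (L k \<omega>)\<^sup>2)"
  shows "AE \<omega> in M. (\<forall>t\<in>{0..T}. summable (\<lambda>k. c k t \<omega> * g k \<omega>)) \<and>
    (\<exists>C. \<forall>t\<in>{0..T}. \<forall>u\<in>{0..T}.
      \<bar>(\<Sum>k. c k t \<omega> * g k \<omega>) - (\<Sum>k. c k u \<omega> * g k \<omega>)\<bar> \<le> C * \<bar>t - u\<bar> powr \<beta>)"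
proof -
  note c_F[measurable] L_F[measurable]
  have c_M [measurable]: "c k t \<in> borel_measurable M" for k t
    by (rule measurable_from_subalg[OF F c_F])
  have g_M [measurable]: "g k \<in> borel_measurable M" for k
    by (rule measurable_from_subalg[OF H g_H])
  \<comment> \<open>The first condition turns the growth rate \<open>1 / q\<close> in
    \<open>n\<close> into at most \<open>\<delta> / 2\<close>, as summation by parts requires. The
    second makes the sum over all dyadic levels converge.\<close>
  obtain q :: nat where q: "2 / \<delta> < real q" "1 / (2 * (\<eta> - \<beta>)) < real q"
    using reals_Archimedean2[of "max (2 / \<delta>) (1 / (2 * (\<eta> - \<beta>)))"] by auto
  have q_pos: "0 < q" using q(1) \<delta> by (metis divide_pos_pos not_gr_zero of_nat_0 order.asym zero_less_numeral)
  have q_\<delta>: "1 / real q \<le> \<delta> / 2" using q(1) q_pos \<delta> by (simp add: field_simps)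
  have q_\<beta>: "1 < 2 * real q * (\<eta> - \<beta>)" using q(2) \<beta> by (simp add: field_simps)
  define b where "b k t \<omega> = real (Suc k) powr \<delta> * c k t \<omega>" for k t \<omega>
  define B where "B n t \<omega> = (\<Sum>k<n. b k t \<omega> * g k \<omega>)" for n t \<omega>
  have [measurable]: "b k t \<in> borel_measurable F" for k t
    unfolding b_def[abs_def] by measurable
  have [measurable]: "B n t \<in> borel_measurable M" for n t
    unfolding B_def[abs_def] b_def[abs_def] by measurable
  define X where "X n i l \<omega> = (B n (T * real (Suc l) / 2 ^ i) \<omega> - B n (T * real l / 2 ^ i) \<omega>) ^ (2 * q)"
    for n i l \<omega>
  have X_nonneg: "0 \<le> X n i l \<omega>" for n i l \<omega>
    unfolding X_def by (rule zero_le_even_power) simp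
  have [measurable]: "X n i l \<in> borel_measurable M" for n i l
    unfolding X_def[abs_def] by measurable
  \<comment> \<open>The first factor makes the sum over \<open>n\<close> converge; the second is the
    inverse of the \<open>2 * q\<close>-th power of the intended increment size
    \<open>(2 powr -\<beta>) ^ i\<close>.\<close>
  define w where "w n i = 1 / (real (Suc n))\<^sup>2 * (2 powr (2 * real q * \<beta>)) ^ i" for n i
  have w_pos: "0 < w n i" for n i by (simp add: w_def)
  define Z where "Z \<omega> = (\<Sum>n. \<Sum>i. \<Sum>l<(2::nat) ^ i. ennreal (w n i * X n i l \<omega>))" for \<omega>
  \<comment> \<open>Written with extended values, the condition makes sense even where the series
    diverges, and the event lies in \<open>F\<close>, as freezing requires.\<close>
  define A where "A m = {\<omega> \<in> space F. (\<Sum>k. ennreal (real (Suc k) powr (2 * \<delta>) * (L k \<omega>)\<^sup>2)) \<le> ennreal (real m)}"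
    for m :: nat
  have A_F: "A m \<in> sets F" for m unfolding A_def by measurable
  have [measurable]: "A m \<in> sets M" for m using A_F F by (auto simp: subalgebra_def)
  have [measurable]: "Z \<in> borel_measurable M" unfolding Z_def[abs_def] by measurable
  define K where "K m = gaussian_moment_constant q * s ^ (2 * q) * (real m * T powr (2 * \<eta>)) ^ q" for m :: nat
  have K_nonneg: "0 \<le> K m" for m using s by (simp add: K_def gaussian_moment_constant_def)
  \<comment> \<open>On \<open>A m\<close> the conditional variance of a level-\<open>i\<close>
    increment is at most \<open>s\<^sup>2 * m * (T / 2 ^ i) powr (2 * \<eta>)\<close>. This holds
    for every \<open>n\<close>, because a partial sum of squares is below the full sum.\<close>
  have moment: "(\<integral>\<^sup>+\<omega>. indicator (A m) \<omega> * ennreal (X n i l \<omega>) \<partial>M) \<le> ennreal (K m * (2 powr (- 2 * real q * \<eta>)) ^ i)"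
    if l: "l < 2 ^ i" for m n i l
  proof -
    define t where "t = T * real (Suc l) / 2 ^ i"
    define u where "u = T * real l / 2 ^ i"
    have "real (Suc l) \<le> 2 ^ i"
      using l by (metis Suc_leI of_nat_le_iff of_nat_numeral of_nat_power)
    then have "T * real (Suc l) \<le> T * 2 ^ i" "T * real l \<le> T * 2 ^ i"
      using T l by (auto intro!: mult_left_mono simp: less_imp_le)
    then have tu: "t \<in> {0..T}" "u \<in> {0..T}"
      using T by (auto simp: t_def u_def pos_divide_le_eq simp del: of_nat_Suc)
    have tu_diff: "\<bar>t - u\<bar> = T / 2 ^ i"
      using T by (simp add: t_def u_def diff_divide_distrib[symmetric] algebra_simps)
    have X_eq: "X n i l \<omega> = (\<Sum>k<n. (b k t \<omega> - b k u \<omega>) * g k \<omega>) ^ (2 * q)" for \<omega>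
      by (simp add: X_def B_def t_def u_def sum_subtractf algebra_simps)
    have "(\<integral>\<^sup>+\<omega>. indicator (A m) \<omega> * ennreal (X n i l \<omega>) \<partial>M) =
        (\<integral>\<^sup>+\<omega>. indicator (A m) \<omega> * ennreal (gaussian_moment_constant q * s ^ (2 * q) *
          (\<Sum>k<n. (b k t \<omega> - b k u \<omega>)\<^sup>2) ^ q) \<partial>M)"
      unfolding X_eq
      by (rule nn_integral_gaussian_sum_moment_indep[OF F H indep_FH g_H _ A_F s indep gauss q_pos]) measurable
    also have "\<dots> \<le> (\<integral>\<^sup>+\<omega>. ennreal (K m * (2 powr (- 2 * real q * \<eta>)) ^ i) \<partial>M)"
    proof (rule nn_integral_mono_AE)
      show "AE \<omega> in M. indicator (A m) \<omega> * ennreal (gaussian_moment_constant q * s ^ (2 * q) *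
          (\<Sum>k<n. (b k t \<omega> - b k u \<omega>)\<^sup>2) ^ q) \<le> ennreal (K m * (2 powr (- 2 * real q * \<eta>)) ^ i)"
        using c_hoelder L_sum
      proof eventually_elim
        case (elim \<omega>)
        show ?case
        proof (cases "\<omega> \<in> A m")
          case True
          have "(b k t \<omega> - b k u \<omega>)\<^sup>2 \<le> real (Suc k) powr (2 * \<delta>) * (L k \<omega>)\<^sup>2 * (T / 2 ^ i) powr (2 * \<eta>)" for k
          proof -
            have "\<bar>c k t \<omega> - c k u \<omega>\<bar> \<le> L k \<omega> * (T / 2 ^ i) powr \<eta>"
              using elim(1) tu unfolding tu_diff[symmetric] by blast
            then have "\<bar>c k t \<omega> - c k u \<omega>\<bar>\<^sup>2 \<le> (L k \<omega> * (T / 2 ^ i) powr \<eta>)\<^sup>2"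
              by (rule power_mono) simp
            then have "(real (Suc k) powr \<delta>)\<^sup>2 * (c k t \<omega> - c k u \<omega>)\<^sup>2 \<le>
                (real (Suc k) powr \<delta>)\<^sup>2 * (L k \<omega> * (T / 2 ^ i) powr \<eta>)\<^sup>2"
              by (intro mult_left_mono) auto
            moreover have "(x powr p)\<^sup>2 = x powr (2 * p)" for x p :: real
              by (simp add: power2_eq_square powr_add[symmetric])
            ultimately show ?thesis
              by (simp add: b_def right_diff_distrib[symmetric] power_mult_distrib mult.assoc del: of_nat_Suc)
          qed
          then have "(\<Sum>k<n. (b k t \<omega> - b k u \<omega>)\<^sup>2) \<le>
              (\<Sum>k<n. real (Suc k) powr (2 * \<delta>) * (L k \<omega>)\<^sup>2) * (T / 2 ^ i) powr (2 * \<eta>)"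
            unfolding sum_distrib_right by (rule sum_mono)
          also have "(\<Sum>k<n. real (Suc k) powr (2 * \<delta>) * (L k \<omega>)\<^sup>2) \<le> real m"
          proof -
            have "ennreal (\<Sum>k. real (Suc k) powr (2 * \<delta>) * (L k \<omega>)\<^sup>2) \<le> ennreal (real m)"
              using True elim(2) by (subst suminf_ennreal2[symmetric]) (auto simp: A_def)
            then have "(\<Sum>k. real (Suc k) powr (2 * \<delta>) * (L k \<omega>)\<^sup>2) \<le> real m"
              by simp
            moreover have "(\<Sum>k<n. real (Suc k) powr (2 * \<delta>) * (L k \<omega>)\<^sup>2) \<le> (\<Sum>k. real (Suc k) powr (2 * \<delta>) * (L k \<omega>)\<^sup>2)"
              by (rule sum_le_suminf[OF elim(2)]) auto
            ultimately show ?thesis by linarith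
          qed
          finally have "(\<Sum>k<n. (b k t \<omega> - b k u \<omega>)\<^sup>2) \<le> real m * (T / 2 ^ i) powr (2 * \<eta>)"
            by (simp add: mult_right_mono)
          then have "(\<Sum>k<n. (b k t \<omega> - b k u \<omega>)\<^sup>2) ^ q \<le> (real m * (T / 2 ^ i) powr (2 * \<eta>)) ^ q"
            by (rule power_mono) (simp add: sum_nonneg)
          also have "(real m * (T / 2 ^ i) powr (2 * \<eta>)) ^ q =
              (real m * T powr (2 * \<eta>)) ^ q * (2 powr (- 2 * real q * \<eta>)) ^ i"
          proof -
            have "((2::real) ^ i) powr (2 * \<eta>) = 2 powr (2 * \<eta> * real i)"
              by (simp add: powr_realpow[symmetric] powr_powr mult.commute)
            then have "(T / 2 ^ i) powr (2 * \<eta>) = T powr (2 * \<eta>) * 2 powr (- (2 * \<eta> * real i))"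
              using T by (simp add: powr_divide powr_minus field_simps)
            moreover have "(2 powr (- (2 * \<eta> * real i))) ^ q = ((2::real) powr (- 2 * real q * \<eta>)) ^ i"
              by (simp add: powr_power algebra_simps)
            ultimately show ?thesis by (simp add: power_mult_distrib)
          qed
          finally have "gaussian_moment_constant q * s ^ (2 * q) * (\<Sum>k<n. (b k t \<omega> - b k u \<omega>)\<^sup>2) ^ q \<le>
              gaussian_moment_constant q * s ^ (2 * q) * ((real m * T powr (2 * \<eta>)) ^ q * (2 powr (- 2 * real q * \<eta>)) ^ i)"
            using s by (intro mult_left_mono) (auto simp: gaussian_moment_constant_def)
          then show ?thesis using True by (simp add: K_def mult.assoc ennreal_leI)
        qed simp
      qed
    qed
    also have "\<dots> = ennreal (K m * (2 powr (- 2 * real q * \<eta>)) ^ i)"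
      by (simp add: emeasure_space_1)
    finally show ?thesis .
  qed
  \<comment> \<open>Ratio of the geometric series over the levels: level \<open>i\<close> has
    \<open>2 ^ i\<close> increments, each contributing its weight times its moment bound. The
    exponent is negative by \<open>q_\<beta>\<close>.\<close>
  define \<theta> where "\<theta> = (2::real) powr (1 - 2 * real q * (\<eta> - \<beta>))"
  have \<theta>: "0 < \<theta>" "\<theta> < 1"
  proof -
    have "\<theta> < 2 powr 0" unfolding \<theta>_def using q_\<beta> by (intro powr_less_mono) auto
    then show "0 < \<theta>" "\<theta> < 1" by (auto simp: \<theta>_def)
  qed
  have Z_int: "(\<integral>\<^sup>+\<omega>. indicator (A m) \<omega> * Z \<omega> \<partial>M) \<noteq> \<infinity>" for m
  proof -
    have "(\<integral>\<^sup>+\<omega>. indicator (A m) \<omega> * Z \<omega> \<partial>M) =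
        (\<integral>\<^sup>+\<omega>. (\<Sum>n. \<Sum>i. \<Sum>l<(2::nat) ^ i. ennreal (w n i) * (indicator (A m) \<omega> * ennreal (X n i l \<omega>))) \<partial>M)"
      unfolding Z_def
      by (intro nn_integral_cong)
         (simp add: ennreal_suminf_cmult[symmetric] sum_distrib_left ennreal_mult' less_imp_le[OF w_pos] ac_simps
           del: ennreal_suminf_cmult)
    also have "\<dots> = (\<Sum>n. \<Sum>i. \<Sum>l<(2::nat) ^ i. ennreal (w n i) * (\<integral>\<^sup>+\<omega>. indicator (A m) \<omega> * ennreal (X n i l \<omega>) \<partial>M))"
      by (simp add: nn_integral_suminf nn_integral_sum nn_integral_cmult)
    also have "\<dots> \<le> (\<Sum>n. \<Sum>i. \<Sum>l<(2::nat) ^ i. ennreal (w n i) * ennreal (K m * (2 powr (- 2 * real q * \<eta>)) ^ i))"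
      by (intro suminf_le sum_mono mult_left_mono moment) auto
    also have "\<dots> = (\<Sum>n. \<Sum>i. ennreal (K m / (real (Suc n))\<^sup>2 * \<theta> ^ i))"
    proof (intro suminf_cong)
      fix n i
      have "(2::real) ^ i * ((2 powr (2 * real q * \<beta>)) ^ i * (2 powr (- 2 * real q * \<eta>)) ^ i) = \<theta> ^ i"
        unfolding power_mult_distrib[symmetric] \<theta>_def
        by (simp add: powr_add powr_diff powr_minus right_diff_distrib field_simps)
      then have eq: "2 ^ i * (w n i * (K m * (2 powr (- 2 * real q * \<eta>)) ^ i)) = K m / (real (Suc n))\<^sup>2 * \<theta> ^ i"
        by (simp add: w_def field_simps)
      have "(\<Sum>l<(2::nat) ^ i. ennreal (w n i) * ennreal (K m * (2 powr (- 2 * real q * \<eta>)) ^ i)) =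
          ennreal (2 ^ i) * ennreal (w n i * (K m * (2 powr (- 2 * real q * \<eta>)) ^ i))"
        using w_pos[of n i] K_nonneg[of m]
        by (simp add: ennreal_mult ennreal_power[symmetric])
      also have "\<dots> = ennreal (K m / (real (Suc n))\<^sup>2 * \<theta> ^ i)"
        unfolding eq[symmetric] using w_pos[of n i] K_nonneg[of m] by (simp add: ennreal_mult)
      finally show "(\<Sum>l<(2::nat) ^ i. ennreal (w n i) * ennreal (K m * (2 powr (- 2 * real q * \<eta>)) ^ i)) =
          ennreal (K m / (real (Suc n))\<^sup>2 * \<theta> ^ i)" .
    qed
    also have "\<dots> = (\<Sum>n. ennreal (K m / (real (Suc n))\<^sup>2 * (1 / (1 - \<theta>))))"
    proof (intro suminf_cong)
      fix n
      have "(\<lambda>i. K m / (real (Suc n))\<^sup>2 * \<theta> ^ i) sums (K m / (real (Suc n))\<^sup>2 * (1 / (1 - \<theta>)))"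
        using \<theta> by (intro sums_mult geometric_sums) auto
      then show "(\<Sum>i. ennreal (K m / (real (Suc n))\<^sup>2 * \<theta> ^ i)) = ennreal (K m / (real (Suc n))\<^sup>2 * (1 / (1 - \<theta>)))"
        using K_nonneg[of m] \<theta> by (subst suminf_ennreal2) (auto simp: sums_iff simp del: of_nat_Suc)
    qed
    also have "\<dots> < \<infinity>"
    proof -
      have "summable (\<lambda>n. 1 / (real (Suc n))\<^sup>2)"
        using inverse_power_summable[of 2, where 'a = real]
        by (subst summable_Suc_iff) (simp add: inverse_eq_divide)
      then have "summable (\<lambda>n. K m * (1 / (1 - \<theta>)) * (1 / (real (Suc n))\<^sup>2))"
        by (rule summable_mult)
      then have "summable (\<lambda>n. K m / (real (Suc n))\<^sup>2 * (1 / (1 - \<theta>)))"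
        by (simp add: field_simps)
      then show ?thesis
        using K_nonneg[of m] \<theta> by (subst suminf_ennreal2) auto
    qed
    finally show ?thesis by simp
  qed
  \<comment> \<open>The \<open>m\<close> with \<open>\<omega> \<in> A m\<close> depends on
    \<open>\<omega>\<close>, so a single null set has to serve all \<open>m\<close>.\<close>
  have Z_AE: "AE \<omega> in M. \<forall>m. indicator (A m) \<omega> * Z \<omega> \<noteq> \<infinity>"
    unfolding AE_all_countable using Z_int by (intro allI nn_integral_PInf_AE) auto
  show ?thesis
    using c_hoelder L_sum Z_AE AE_space
  proof eventually_elim
    case (elim \<omega>)
    have "Z \<omega> \<noteq> \<infinity>"
    proof -
      obtain m :: nat where "(\<Sum>k. real (Suc k) powr (2 * \<delta>) * (L k \<omega>)\<^sup>2) \<le> real m"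
        using real_arch_simple by blast
      then have "\<omega> \<in> A m"
        using elim(2,4) F by (auto simp: A_def subalgebra_def suminf_ennreal2 ennreal_leI simp del: of_nat_Suc)
      then show ?thesis using elim(3)[rule_format, of m] by simp
    qed
    then obtain z where z: "0 \<le> z" "Z \<omega> = ennreal z" by (cases "Z \<omega>") auto
    \<comment> \<open>Each single term of \<open>Z\<close> is at most \<open>z\<close>; solving for
      the increment takes a \<open>2 * q\<close>-th root, which turns \<open>1 / w n i\<close> into
      \<open>(n+1)^(1/q)\<close> times \<open>(2 powr -\<beta>) ^ i\<close>.\<close>
    define z' where "z' = z powr (1 / (2 * real q))"
    have z': "z' ^ (2 * q) = z"
      using z(1) q_pos by (cases "z = 0") (simp_all add: z'_def powr_power zero_power)
    have incr: "\<bar>B n (T * real (Suc l) / 2 ^ i) \<omega> - B n (T * real l / 2 ^ i) \<omega>\<bar> \<le>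
        z' * real (Suc n) powr (\<delta> / 2) * (2 powr -\<beta>) ^ i" if "l < 2 ^ i" for n i l
    proof -
      define y where "y = \<bar>B n (T * real (Suc l) / 2 ^ i) \<omega> - B n (T * real l / 2 ^ i) \<omega>\<bar>"
      have y: "X n i l \<omega> = y ^ (2 * q)" by (simp add: X_def y_def power_even_abs)
      have "ennreal (w n i * X n i l \<omega>) \<le> (\<Sum>l<(2::nat) ^ i. ennreal (w n i * X n i l \<omega>))"
        using that by (intro member_le_sum) auto
      also have "\<dots> \<le> (\<Sum>i. \<Sum>l<(2::nat) ^ i. ennreal (w n i * X n i l \<omega>))"
        by (rule ennreal_le_suminf)
      also have "\<dots> \<le> Z \<omega>" unfolding Z_def by (rule ennreal_le_suminf)
      finally have "w n i * y ^ (2 * q) \<le> z" using z by (simp add: y)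
      then have "y ^ (2 * q) \<le> z / w n i" using w_pos[of n i] by (simp add: field_simps)
      also have "z / w n i = (z' * real (Suc n) powr (1 / real q) * (2 powr -\<beta>) ^ i) ^ (2 * q)"
      proof -
        have "(real (Suc n) powr (1 / real q)) ^ (2 * q) = (real (Suc n))\<^sup>2"
          using q_pos by (simp add: powr_power del: of_nat_Suc)
        moreover have "((2 powr -\<beta>) ^ i) ^ (2 * q) = 1 / (2 powr (2 * real q * \<beta>)) ^ i"
        proof -
          have "((2 powr -\<beta>) ^ i) ^ (2 * q) = ((2 powr -\<beta>) ^ (2 * q)) ^ i"
            by (simp only: power_mult[symmetric] mult.commute)
          also have "(2 powr -\<beta>) ^ (2 * q) = 1 / 2 powr (2 * real q * \<beta>)"
            by (simp add: powr_minus_divide power_one_over powr_power ac_simps)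
          finally show ?thesis by (simp add: power_one_over)
        qed
        ultimately show ?thesis by (simp add: power_mult_distrib z' w_def)
      qed
      finally have "y \<le> z' * real (Suc n) powr (1 / real q) * (2 powr -\<beta>) ^ i"
        using q_pos by (subst (asm) power_mono_iff) (auto simp: y_def z'_def)
      also have "\<dots> \<le> z' * real (Suc n) powr (\<delta> / 2) * (2 powr -\<beta>) ^ i"
        using q_\<delta> by (intro mult_right_mono mult_left_mono powr_mono) (auto simp: z'_def)
      finally show ?thesis by (simp add: y_def)
    qed
    define h where "h = (1 + 2 powr -\<beta>) / (1 - 2 powr -\<beta>) * (2 / T) powr \<beta>"
    have B_hoelder: "\<bar>B n t \<omega> - B n u \<omega>\<bar> \<le> z' * real (Suc n) powr (\<delta> / 2) * h * \<bar>t - u\<bar> powr \<beta>"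
      if "t \<in> {0..T}" "u \<in> {0..T}" for n t u
      unfolding h_def
    proof (rule hoelder_of_dyadic_increments[OF T \<beta>(1) _ _ incr that])
      \<comment> \<open>Continuity serves only to pass from dyadic times to all times; the constants
        \<open>L k \<omega>\<close> do not enter the resulting bound.\<close>
      have "continuous_on {0..T} (\<lambda>t. c k t \<omega>)" for k
        using elim(1) \<beta> by (intro continuous_on_of_hoelder[of \<eta> _ _ "L k \<omega>"]) auto
      then show "continuous_on {0..T} (\<lambda>t. B n t \<omega>)"
        unfolding B_def b_def by (intro continuous_intros)
    qed (auto simp: z'_def)
    \<comment> \<open>Summation by parts removes the artificial weight
      \<open>(k+1)^\<delta>\<close>. It is pathwise, so the exceptional set does not depend on
      \<open>t\<close> and \<open>u\<close>.\<close>
    have series: "summable (\<lambda>k. (c k t \<omega> - c k u \<omega>) * g k \<omega>) \<and>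
        \<bar>\<Sum>k. (c k t \<omega> - c k u \<omega>) * g k \<omega>\<bar> \<le> 3 * (z' * h * \<bar>t - u\<bar> powr \<beta>)"
      if tu: "t \<in> {0..T}" "u \<in> {0..T}" for t u
    proof -
      have "\<bar>\<Sum>k<n. (b k t \<omega> - b k u \<omega>) * g k \<omega>\<bar> \<le> (z' * h * \<bar>t - u\<bar> powr \<beta>) * real (Suc n) powr (\<delta> / 2)" for n
        using B_hoelder[OF tu, of n] by (simp add: B_def sum_subtractf algebra_simps)
      note weighted_sums_of_slowly_growing_partial_sums[OF \<delta> this]
      moreover have "real (Suc k) powr -\<delta> * ((b k t \<omega> - b k u \<omega>) * g k \<omega>) = (c k t \<omega> - c k u \<omega>) * g k \<omega>" for k
        by (simp add: b_def powr_minus right_diff_distrib[symmetric] del: of_nat_Suc)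
      ultimately show ?thesis by (simp only:)
    qed
    \<comment> \<open>Since the coefficients vanish at time 0, the series at time \<open>t\<close>
      is itself an increment series.\<close>
    have summable: "summable (\<lambda>k. c k t \<omega> * g k \<omega>)" if "t \<in> {0..T}" for t
      using series[OF that, of 0] T by (simp add: c_0)
    have "\<bar>(\<Sum>k. c k t \<omega> * g k \<omega>) - (\<Sum>k. c k u \<omega> * g k \<omega>)\<bar> \<le> 3 * z' * h * \<bar>t - u\<bar> powr \<beta>"
      if "t \<in> {0..T}" "u \<in> {0..T}" for t u
      using series[OF that] suminf_diff[OF summable[OF that(1)] summable[OF that(2)]]
      by (simp add: left_diff_distrib)
    with summable show ?case by blast
  qed
qed

section \<open>The wave kernel\<close>

text \<open>The primitive \<open>F\<close> is continuous across the singularity, so the fundamental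
  theorem of calculus with exceptional point \<open>b\<close> covers every position of
  \<open>b\<close>. Subadditivity of the square root makes the bound uniform in
  \<open>b\<close>.\<close>

lemma nn_integral_inverse_sqrt_le:
  fixes b u t :: real
  assumes ut: "u \<le> t"
  shows "(\<integral>\<^sup>+v. indicator {u..t} v * ennreal (if b < v then 1 / sqrt (v - b) else 0) \<partial>lborel) \<le>
    ennreal (2 * sqrt (t - u))"
proof -
  define F where "F v = 2 * sqrt (max 0 (v - b))" for v
  define f where "f v = (if b < v then 1 / sqrt (v - b) else 0)" for v
  have "(f has_integral F t - F u) {u..t}"
  proof (rule fundamental_theorem_of_calculus_strong[of "{b}"])
    show "continuous_on {u..t} F" unfolding F_def by (intro continuous_intros)
    fix v assume "v \<in> {u..t} - {b}"
    then consider "b < v" | "v < b" by fastforce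
    then have "(F has_real_derivative f v) (at v)"
    proof cases
      case 1
      have "((\<lambda>v. 2 * sqrt (v - b)) has_real_derivative f v) (at v)"
        using 1 by (auto intro!: derivative_eq_intros simp: f_def field_simps)
      moreover have "\<forall>\<^sub>F w in nhds v. F w = 2 * sqrt (w - b)"
        using eventually_nhds_in_open[of "{b<..}" v] 1 by (auto elim!: eventually_mono simp: F_def)
      ultimately show ?thesis
        using DERIV_cong_ev[of v v F "\<lambda>v. 2 * sqrt (v - b)" "f v" "f v"] by simp
    next
      case 2
      have "\<forall>\<^sub>F w in nhds v. F w = 0"
        using eventually_nhds_in_open[of "{..<b}" v] 2 by (auto elim!: eventually_mono simp: F_def)
      then show ?thesis
        using DERIV_cong_ev[of v v F "\<lambda>v. 0" "f v" "f v"] 2 by (simp add: f_def)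
    qed
    then show "(F has_vector_derivative f v) (at v)"
      by (simp add: has_real_derivative_iff_has_vector_derivative)
  qed (use ut in auto)
  then have "(\<integral>\<^sup>+v. indicator {u..t} v * f v \<partial>lborel) = ennreal (F t - F u)"
    using nn_integral_has_integral_lebesgue[of "{u..t}" f] by (simp add: f_def[abs_def])
  moreover have "(\<integral>\<^sup>+v. indicator {u..t} v * f v \<partial>lborel) = (\<integral>\<^sup>+v. indicator {u..t} v * ennreal (f v) \<partial>lborel)"
    by (intro nn_integral_cong) (auto split: split_indicator)
  moreover have "F t - F u \<le> 2 * sqrt (t - u)"
  proof -
    have "sqrt (max 0 (t - b)) \<le> sqrt (max 0 (u - b) + (t - u))"
      using ut by simp
    also have "\<dots> \<le> sqrt (max 0 (u - b)) + sqrt (t - u)"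
      using ut by (intro sqrt_add_le_add_sqrt) auto
    finally show ?thesis by (simp add: F_def)
  qed
  ultimately show ?thesis unfolding f_def[symmetric] by (metis ennreal_leI)
qed

text \<open>The substitution \<open>v = t - \<tau>\<close> moves the singularity of the kernel to a point independent of \<open>t\<close>.\<close>
lemma Gker_eq_convolution:
  fixes \<sigma> :: "real^2 \<Rightarrow> real \<Rightarrow> real"
  assumes a: "0 < a"
  shows "Gker a \<sigma> x y t = 1 / (2 * pi * a) *
    (\<integral>v. (if dist x y < a * v then 1 / sqrt (a\<^sup>2 * v\<^sup>2 - (dist x y)\<^sup>2) else 0) *
         (if v \<le> t then \<sigma> y (t - v) else 0) \<partial>lborel)"
proof -
  define r where "r = dist x y"
  define h where "h v = (if r < a * v then 1 / sqrt (a\<^sup>2 * v\<^sup>2 - r\<^sup>2) else 0) *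
         (if v \<le> t then \<sigma> y (t - v) else 0)" for v
  \<comment> \<open>The interval is closed while the kernel asks for a strict inequality. At the
    endpoint \<open>\<tau> = t - r / a\<close> the root is 0, and division by zero gives 0 on the
    right as well.\<close>
  have h: "h (t - \<tau>) = indicator {0..t - r / a} \<tau> * (\<sigma> y \<tau> / sqrt (a\<^sup>2 * (t - \<tau>)\<^sup>2 - r\<^sup>2))" for \<tau>
  proof -
    have "a\<^sup>2 * (t - \<tau>)\<^sup>2 - r\<^sup>2 = 0" if "\<tau> = t - r / a"
      using that a by (simp add: power_divide)
    moreover have "r < a * (t - \<tau>) \<longleftrightarrow> \<tau> < t - r / a"
      using a by (simp add: field_simps)
    ultimately show ?thesis
      by (cases "\<tau> = t - r / a") (auto simp: h_def split: split_indicator)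
  qed
  have "integral\<^sup>L lborel h = (\<integral>\<tau>. h (t + (-1) * \<tau>) \<partial>lborel)"
    using lborel_integral_real_affine[of "-1" h t] by simp
  also have "\<dots> = (LBINT \<tau>:{0..t - r / a}. \<sigma> y \<tau> / sqrt (a\<^sup>2 * (t - \<tau>)\<^sup>2 - r\<^sup>2))"
    unfolding set_lebesgue_integral_def by (simp add: h)
  finally have *: "integral\<^sup>L lborel h = (LBINT \<tau>:{0..t - r / a}. \<sigma> y \<tau> / sqrt (a\<^sup>2 * (t - \<tau>)\<^sup>2 - r\<^sup>2))" .
  \<comment> \<open>Outside the light cone the two cut-offs in \<open>h\<close> exclude each other,
    so the case distinction in \<open>Gker\<close> is already built into the integral.\<close>
  have "h v = 0" if "\<not> r < a * t" for v
  proof -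
    have "r < a * t" if "r < a * v" "v \<le> t"
      using that a mult_left_mono[of v t a] by linarith
    then show ?thesis using that by (auto simp: h_def)
  qed
  then have "integral\<^sup>L lborel h = 0" if "\<not> r < a * t"
    using that by (simp add: fun_eq_iff[of h "\<lambda>_. 0", THEN iffD2])
  then show ?thesis
    using * unfolding Gker_def h_def r_def by (simp add: dist_commute)
qed

text \<open>Factor \<open>a\<^sup>2 * v\<^sup>2 - r\<^sup>2\<close> as
  \<open>(a * v + r) * (a * v - r)\<close> and bound the first factor below by \<open>2 * r\<close>.
  What remains is a pure inverse square root singularity at \<open>r / a\<close>, with the
  dependence on \<open>r\<close> pulled out as \<open>r powr (-1/2)\<close>.\<close>

lemma wave_kernel_le:
  fixes a r v :: real
  assumes a: "0 < a" and r: "0 < r"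
  shows "(if r < a * v then 1 / sqrt (a\<^sup>2 * v\<^sup>2 - r\<^sup>2) else 0) \<le>
    1 / sqrt (2 * r * a) * (if r / a < v then 1 / sqrt (v - r / a) else 0)"
proof (cases "r < a * v")
  case True
  then have v: "r / a < v" using a by (simp add: field_simps)
  have "2 * r * a * (v - r / a) = 2 * r * (a * v - r)"
    using a by (simp add: field_simps)
  also have "\<dots> \<le> (a * v + r) * (a * v - r)"
    using True r by (intro mult_right_mono) auto
  also have "\<dots> = a\<^sup>2 * v\<^sup>2 - r\<^sup>2"
    by (simp add: power2_eq_square algebra_simps)
  finally have le: "sqrt (2 * r * a) * sqrt (v - r / a) \<le> sqrt (a\<^sup>2 * v\<^sup>2 - r\<^sup>2)"
    by (simp add: real_sqrt_mult[symmetric])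
  have pos: "0 < sqrt (2 * r * a) * sqrt (v - r / a)"
    using r a v by simp
  have "1 / sqrt (a\<^sup>2 * v\<^sup>2 - r\<^sup>2) \<le> 1 / (sqrt (2 * r * a) * sqrt (v - r / a))"
    by (rule frac_le[OF zero_le_one order_refl pos le])
  then show ?thesis using True v by simp
next
  case False
  then show ?thesis using a r by auto
qed

text \<open>After the substitution both integrals share the kernel \<open>J\<close>, and their
  difference splits at \<open>v = u\<close>. Below \<open>u\<close> both values of
  \<open>\<sigma>\<close> occur and its Hoelder condition applies; between \<open>u\<close> and
  \<open>t\<close> only one occurs and is bounded by \<open>B\<close>. Integrating the singularity
  over these ranges gives \<open>sqrt u\<close> and \<open>sqrt (t - u)\<close>, and the latter
  limits the exponent to 1/2.\<close>

lemma Gker_hoelder: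
  fixes \<sigma> :: "real^2 \<Rightarrow> real \<Rightarrow> real"
  assumes a: "0 < a" and xy: "x \<noteq> y"
    and cont: "continuous_on {0..} (\<sigma> y)"
    and bdd: "\<And>t. 0 \<le> t \<Longrightarrow> \<bar>\<sigma> y t\<bar> \<le> B"
    and hoelder: "\<And>t u. 0 \<le> t \<Longrightarrow> 0 \<le> u \<Longrightarrow> \<bar>\<sigma> y t - \<sigma> y u\<bar> \<le> \<bar>t - u\<bar> powr \<gamma>"
    and u: "0 \<le> u" and ut: "u \<le> t"
  shows "\<bar>Gker a \<sigma> x y t - Gker a \<sigma> x y u\<bar> \<le>
    1 / (pi * a * sqrt (2 * a)) * (sqrt u * (t - u) powr \<gamma> + B * sqrt (t - u)) / sqrt (dist x y)"
proof -
  define r where "r = dist x y"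
  have r: "0 < r" using xy by (simp add: r_def)
  have B: "0 \<le> B" using bdd[of 0] by linarith
  define J where "J v = (if r < a * v then 1 / sqrt (a\<^sup>2 * v\<^sup>2 - r\<^sup>2) else 0)" for v
  define j where "j v = (if r / a < v then 1 / sqrt (v - r / a) else 0)" for v
  define c where "c = 1 / sqrt (2 * r * a)"
  define h where "h t v = (if v \<le> t then \<sigma> y (t - v) else 0)" for t v
  have c: "0 \<le> c" using r a by (simp add: c_def)
  have J_nonneg: "0 \<le> J v" for v
  proof -
    have "r\<^sup>2 \<le> a\<^sup>2 * v\<^sup>2" if "r < a * v"
      using power_mono[of r "a * v" 2] that r by (simp add: power_mult_distrib)
    then show ?thesis by (simp add: J_def)
  qed
  have J_le: "J v \<le> c * j v" for v
    using wave_kernel_le[OF a r, of v] by (simp add: J_def c_def j_def)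
  have j_nonneg: "0 \<le> j v" for v by (simp add: j_def)
  have J_zero: "J v = 0" if "v \<le> 0" for v
    using that a r mult_nonneg_nonpos[of a v] by (simp add: J_def)
  have [measurable]: "J \<in> borel_measurable borel" "j \<in> borel_measurable borel"
    unfolding J_def[abs_def] j_def[abs_def] by measurable
  have h_meas [measurable]: "h t \<in> borel_measurable borel" for t
  proof -
    \<comment> \<open>Nothing is known about \<open>\<sigma>\<close> at negative times; truncating
      the time at 0 gives a globally continuous function that agrees with \<open>h t\<close>
      wherever \<open>v \<le> t\<close>.\<close>
    have "continuous_on UNIV (\<lambda>v. \<sigma> y (max 0 (t - v)))"
      by (intro continuous_on_compose2[OF cont] continuous_intros) auto
    then have [measurable]: "(\<lambda>v. \<sigma> y (max 0 (t - v))) \<in> borel_measurable borel"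
      by (rule borel_measurable_continuous_onI)
    have "h t = (\<lambda>v. if v \<le> t then \<sigma> y (max 0 (t - v)) else 0)"
      by (auto simp: h_def)
    then show ?thesis by simp
  qed
  have int_j: "(\<integral>\<^sup>+v. indicator {u..t} v * ennreal (j v) \<partial>lborel) \<le> ennreal (2 * sqrt (t - u))"
    if "u \<le> t" for u t
    using nn_integral_inverse_sqrt_le[OF that, of "r / a"] by (simp add: j_def)
  have int: "integrable lborel (\<lambda>v. J v * h w v)" if "0 \<le> w" for w
  proof (rule integrableI_bounded)
    have "(\<integral>\<^sup>+v. ennreal (norm (J v * h w v)) \<partial>lborel) \<le>
        (\<integral>\<^sup>+v. ennreal (c * B) * (indicator {0..w} v * ennreal (j v)) \<partial>lborel)"
    proof (intro nn_integral_mono)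
      fix v
      show "ennreal (norm (J v * h w v)) \<le> ennreal (c * B) * (indicator {0..w} v * ennreal (j v))"
      proof (cases "v \<in> {0..w}")
        case True
        have "norm (J v * h w v) \<le> c * j v * B"
          unfolding real_norm_def abs_mult h_def
          using True bdd[of "w - v"] J_le[of v] J_nonneg[of v] c j_nonneg[of v]
          by (intro mult_mono) auto
        then show ?thesis
          using True c B j_nonneg[of v] by (simp add: ennreal_mult[symmetric] ennreal_leI ac_simps)
      qed (auto simp: J_zero h_def)
    qed
    also have "\<dots> = ennreal (c * B) * (\<integral>\<^sup>+v. indicator {0..w} v * ennreal (j v) \<partial>lborel)"
      by (rule nn_integral_cmult) simp
    also have "\<dots> \<le> ennreal (c * B) * ennreal (2 * sqrt (w - 0))"
      using that by (intro mult_left_mono int_j) auto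
    also have "\<dots> < \<infinity>" by (simp add: ennreal_mult_less_top)
    finally show "(\<integral>\<^sup>+v. ennreal (norm (J v * h w v)) \<partial>lborel) < \<infinity>" .
  qed simp
  define D where "D = (\<integral>v. J v * h t v - J v * h u v \<partial>lborel)"
  have D: "D = (\<integral>v. J v * h t v \<partial>lborel) - (\<integral>v. J v * h u v \<partial>lborel)"
    unfolding D_def using u ut by (intro Bochner_Integration.integral_diff int) auto
  have "ennreal \<bar>D\<bar> \<le> (\<integral>\<^sup>+v. ennreal (norm (J v * h t v - J v * h u v)) \<partial>lborel)"
    using integral_norm_bound_ennreal[of lborel "\<lambda>v. J v * h t v - J v * h u v"] int u ut
    by (simp add: D_def)
  also have "\<dots> \<le> (\<integral>\<^sup>+v. ennreal (c * (t - u) powr \<gamma>) * (indicator {0..u} v * ennreal (j v)) +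
      ennreal (c * B) * (indicator {u..t} v * ennreal (j v)) \<partial>lborel)"
  proof (intro nn_integral_mono)
    fix v
    have split: "J v * h t v - J v * h u v = J v * (h t v - h u v)" by (simp add: algebra_simps)
    have mono: "ennreal (norm (J v * (h t v - h u v))) \<le> ennreal (c * C) * ennreal (j v)"
      if "\<bar>h t v - h u v\<bar> \<le> C" for C
    proof -
      have "0 \<le> C" using that by linarith
      have "norm (J v * (h t v - h u v)) \<le> (c * j v) * C"
        unfolding real_norm_def abs_mult
        using that J_le[of v] J_nonneg[of v] c j_nonneg[of v] by (intro mult_mono) auto
      then show ?thesis
        using c \<open>0 \<le> C\<close> j_nonneg[of v] by (simp add: ennreal_mult[symmetric] ennreal_leI ac_simps)
    qed
    consider "v \<le> 0" | "0 < v" "v \<le> u" | "0 < v" "u < v" "v \<le> t" | "t < v" by linarith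
    then show "ennreal (norm (J v * h t v - J v * h u v)) \<le>
        ennreal (c * (t - u) powr \<gamma>) * (indicator {0..u} v * ennreal (j v)) +
        ennreal (c * B) * (indicator {u..t} v * ennreal (j v))"
    proof cases
      case 1
      then show ?thesis by (simp add: J_zero)
    next
      case 2
      have "\<bar>h t v - h u v\<bar> \<le> (t - u) powr \<gamma>"
        using 2 ut hoelder[of "t - v" "u - v"] by (simp add: h_def)
      from mono[OF this] show ?thesis
        using 2 unfolding split by (intro add_increasing2) auto
    next
      case 3
      have "\<bar>h t v - h u v\<bar> \<le> B" using 3 bdd[of "t - v"] by (simp add: h_def)
      from mono[OF this] show ?thesis using 3 unfolding split by simp
    next
      case 4
      then show ?thesis using ut by (simp add: h_def)
    qed
  qed
  also have "\<dots> = ennreal (c * (t - u) powr \<gamma>) * (\<integral>\<^sup>+v. indicator {0..u} v * ennreal (j v) \<partial>lborel) +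
      ennreal (c * B) * (\<integral>\<^sup>+v. indicator {u..t} v * ennreal (j v) \<partial>lborel)"
    by (subst nn_integral_add) (simp_all add: nn_integral_cmult)
  also have "\<dots> \<le> ennreal (c * (t - u) powr \<gamma>) * ennreal (2 * sqrt (u - 0)) + ennreal (c * B) * ennreal (2 * sqrt (t - u))"
    using u ut by (intro add_mono mult_left_mono int_j) auto
  also have "\<dots> = ennreal (c * (t - u) powr \<gamma> * (2 * sqrt u) + c * B * (2 * sqrt (t - u)))"
    using c B u ut by (simp add: ennreal_mult[symmetric] ennreal_plus[symmetric] del: ennreal_plus)
  finally have D_le: "\<bar>D\<bar> \<le> c * (t - u) powr \<gamma> * (2 * sqrt u) + c * B * (2 * sqrt (t - u))"
    using c B u ut by (subst (asm) ennreal_le_iff) auto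
  have G: "Gker a \<sigma> x y w = 1 / (2 * pi * a) * (\<integral>v. J v * h w v \<partial>lborel)" for w
    unfolding Gker_eq_convolution[OF a] J_def h_def r_def ..
  have "Gker a \<sigma> x y t - Gker a \<sigma> x y u = 1 / (2 * pi * a) * D"
    unfolding G D by (simp add: algebra_simps)
  then have "\<bar>Gker a \<sigma> x y t - Gker a \<sigma> x y u\<bar> = 1 / (2 * pi * a) * \<bar>D\<bar>"
    using a by (simp add: abs_mult)
  also have "\<dots> \<le> 1 / (2 * pi * a) * (c * (t - u) powr \<gamma> * (2 * sqrt u) + c * B * (2 * sqrt (t - u)))"
    using D_le a by (intro mult_left_mono) auto
  also have "\<dots> = 1 / (pi * a * sqrt (2 * a)) * (sqrt u * (t - u) powr \<gamma> + B * sqrt (t - u)) / sqrt r"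
    using a r by (simp add: c_def real_sqrt_mult field_simps)
  finally show ?thesis by (simp add: r_def)
qed

text \<open>Truncating the time at 0 does not change the integrand on the integration interval and
  makes it jointly measurable in \<open>y\<close> and the time, so the parameter integral is
  measurable.\<close>

lemma Gker_measurable:
  fixes \<sigma> :: "real^2 \<Rightarrow> real \<Rightarrow> real"
  assumes cont: "continuous_on (UNIV \<times> {0..}) (\<lambda>(y, t). \<sigma> y t)"
  shows "(\<lambda>y. Gker a \<sigma> x y t) \<in> borel_measurable borel"
proof -
  have "continuous_on UNIV (\<lambda>p :: (real^2) \<times> real. (\<lambda>(y, t). \<sigma> y t) (fst p, max 0 (snd p)))"
    by (intro continuous_on_compose2[OF cont] continuous_intros) auto
  then have "(\<lambda>p :: (real^2) \<times> real. \<sigma> (fst p) (max 0 (snd p))) \<in> borel_measurable (borel \<Otimes>\<^sub>M borel)"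
    unfolding borel_prod by (intro borel_measurable_continuous_onI) simp
  then have [measurable]: "(\<lambda>p :: (real^2) \<times> real. \<sigma> (fst p) (max 0 (snd p))) \<in> borel_measurable (borel \<Otimes>\<^sub>M lborel)"
    by (subst measurable_cong_sets[OF sets_pair_measure_cong[OF refl sets_lborel] refl])
  have *: "(LBINT \<tau>:{0..t - dist x y / a}. \<sigma> y \<tau> / sqrt (a\<^sup>2 * (t - \<tau>)\<^sup>2 - (dist y x)\<^sup>2)) =
     (\<integral>\<tau>. (if 0 \<le> \<tau> \<and> \<tau> \<le> t - dist x y / a then
        \<sigma> (fst (y, \<tau>)) (max 0 (snd (y, \<tau>))) / sqrt (a\<^sup>2 * (t - \<tau>)\<^sup>2 - (dist y x)\<^sup>2) else 0) \<partial>lborel)" for y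
    unfolding set_lebesgue_integral_def
    by (intro Bochner_Integration.integral_cong) (auto split: split_indicator)
  show ?thesis
    unfolding Gker_def * by measurable
qed

text \<open>Both exponents are lowered to the smaller one at the cost of powers of \<open>T\<close>.
  The ball reflects finite propagation speed: farther sources are not felt before time
  \<open>T\<close>. It matters because negative powers of \<phi> are controlled only on bounded
  sets. The point \<open>y = x\<close> is excluded since division by zero would turn the bound into
  0.\<close>

lemma Gker_hoelder_uniform:
  fixes \<sigma> :: "real^2 \<Rightarrow> real \<Rightarrow> real"
  assumes a: "0 < a"
    and cont: "\<And>y. continuous_on {0..} (\<sigma> y)"
    and bdd: "\<And>y t. 0 \<le> t \<Longrightarrow> \<bar>\<sigma> y t\<bar> \<le> B"
    and hoelder: "\<And>y t u. 0 \<le> t \<Longrightarrow> 0 \<le> u \<Longrightarrow> \<bar>\<sigma> y t - \<sigma> y u\<bar> \<le> \<bar>t - u\<bar> powr \<gamma>"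
    and T: "0 < T"
  shows "\<exists>K\<ge>0. \<forall>y t u. y \<noteq> x \<longrightarrow> t \<in> {0..T} \<longrightarrow> u \<in> {0..T} \<longrightarrow>
    \<bar>Gker a \<sigma> x y t - Gker a \<sigma> x y u\<bar> \<le>
      K * indicator (ball x (a * T)) y / sqrt (dist x y) * \<bar>t - u\<bar> powr (min \<gamma> (1 / 2))"
proof -
  define \<eta> where "\<eta> = min \<gamma> (1 / 2)"
  have \<eta>: "\<eta> \<le> \<gamma>" "\<eta> \<le> 1 / 2" by (auto simp: \<eta>_def)
  have B: "0 \<le> B" using bdd[of 0 undefined] by linarith
  define K where "K = 1 / (pi * a * sqrt (2 * a)) * (sqrt T * T powr (\<gamma> - \<eta>) + B * T powr (1 / 2 - \<eta>))"
  have K: "0 \<le> K" using a B T by (simp add: K_def)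
  have ordered: "\<bar>Gker a \<sigma> x y t - Gker a \<sigma> x y u\<bar> \<le> K / sqrt (dist x y) * \<bar>t - u\<bar> powr \<eta>"
    if y: "y \<noteq> x" and u: "0 \<le> u" "u \<le> t" and t: "t \<le> T" for y t u
  proof -
    have "\<bar>Gker a \<sigma> x y t - Gker a \<sigma> x y u\<bar> \<le>
        1 / (pi * a * sqrt (2 * a)) * (sqrt u * (t - u) powr \<gamma> + B * sqrt (t - u)) / sqrt (dist x y)"
      by (rule Gker_hoelder[where \<gamma> = \<gamma>]) (use a y cont bdd hoelder u in auto)
    also have "\<dots> \<le> 1 / (pi * a * sqrt (2 * a)) *
        (sqrt T * (T powr (\<gamma> - \<eta>) * (t - u) powr \<eta>) + B * (T powr (1 / 2 - \<eta>) * (t - u) powr \<eta>)) / sqrt (dist x y)"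
      using a B T u t \<eta> powr_le_powr_smaller_exponent[of "t - u" T \<eta> "1 / 2"]
      by (intro divide_right_mono mult_left_mono add_mono mult_mono powr_le_powr_smaller_exponent)
         (auto simp: powr_half_sqrt)
    also have "\<dots> = K / sqrt (dist x y) * \<bar>t - u\<bar> powr \<eta>"
      using u by (simp add: K_def algebra_simps)
    finally show ?thesis .
  qed
  have "\<bar>Gker a \<sigma> x y t - Gker a \<sigma> x y u\<bar> \<le>
      K * indicator (ball x (a * T)) y / sqrt (dist x y) * \<bar>t - u\<bar> powr \<eta>"
    if y: "y \<noteq> x" and tu: "t \<in> {0..T}" "u \<in> {0..T}" for y t u
  proof (cases "y \<in> ball x (a * T)")
    case True
    then show ?thesis
      using ordered[OF y, of u t] ordered[OF y, of t u] tu
      by (cases "u \<le> t") (auto simp: abs_minus_commute)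
  next
    case False
    have "Gker a \<sigma> x y w = 0" if "w \<in> {0..T}" for w
    proof -
      have "a * w \<le> a * T" using that a by simp
      then show ?thesis using False by (simp add: Gker_def)
    qed
    then show ?thesis using tu K by simp
  qed
  with K show ?thesis unfolding \<eta>_def by blast
qed

section \<open>Size of the LePage coefficients\<close>

text \<open>The integrand is half the exponential density of rate 2.\<close>

lemma nn_integral_exp_neg_exponential:
  "(\<integral>\<^sup>+x. ennreal (exponential_density 1 x) * ennreal (exp (- x)) \<partial>lborel) = ennreal (1 / 2)"
proof -
  have "(\<integral>\<^sup>+x. ennreal (exponential_density 1 x) * ennreal (exp (- x)) \<partial>lborel) =
      (\<integral>\<^sup>+x. ennreal (1 / 2) * ennreal (exponential_density 2 x) \<partial>lborel)"
    by (intro nn_integral_cong)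
       (simp add: exponential_density_def ennreal_mult''[symmetric] exp_add[symmetric] mult.commute
         del: ennreal_half)
  also have "\<dots> = ennreal (1 / 2) * (\<integral>\<^sup>+x. ennreal (exponential_density 2 x) \<partial>lborel)"
    by (rule nn_integral_cmult) simp
  also have "(\<integral>\<^sup>+x. ennreal (exponential_density 2 x) \<partial>lborel) = 1"
    using nn_integral_erlang_ith_moment[of 2 0 0] by simp
  finally show ?thesis by simp
qed

text \<open>Exponential moments replace the law of large numbers: the Laplace transform of \<Gamma>
  at 1 is \<open>(1/2) ^ Suc k\<close> and \<open>exp (1/2) < 2\<close>, so the sum of
  \<open>exp ((k+1)/2 - \<Gamma> k)\<close> has finite expectation. Almost surely this sum is finite
  and bounds each of its terms; taking logarithms gives the claim.\<close>

lemma (in prob_space) poisson_arrivals_grow_linearly: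
  fixes \<Gamma> :: "nat \<Rightarrow> 'a \<Rightarrow> real"
  assumes indep: "indep_vars (\<lambda>_. borel) (\<lambda>k \<omega>. \<Gamma> k \<omega> - (if k = 0 then 0 else \<Gamma> (k - 1) \<omega>)) UNIV"
    and exp: "\<And>k. distributed M lborel (\<lambda>\<omega>. \<Gamma> k \<omega> - (if k = 0 then 0 else \<Gamma> (k - 1) \<omega>))
      (\<lambda>r. ennreal (exponential_density 1 r))"
  shows "AE \<omega> in M. \<exists>C. \<forall>k. real (Suc k) / 2 - C \<le> \<Gamma> k \<omega>"
proof -
  define X where "X k \<omega> = \<Gamma> k \<omega> - (if k = 0 then 0 else \<Gamma> (k - 1) \<omega>)" for k \<omega>
  have X_indep: "indep_vars (\<lambda>_. borel) X UNIV"
    using indep by (simp add: X_def[abs_def])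
  have X_exp: "distributed M lborel (X k) (\<lambda>r. ennreal (exponential_density 1 r))" for k
    using exp[of k] by (simp add: X_def[abs_def])
  have X_M: "X k \<in> borel_measurable M" for k
    using distributed_measurable[OF X_exp] by simp
  have \<Gamma>_X: "\<Gamma> k \<omega> = (\<Sum>i\<le>k. X i \<omega>)" for k \<omega>
    by (induction k) (auto simp: X_def)
  have \<Gamma>_M [measurable]: "\<Gamma> k \<in> borel_measurable M" for k
    unfolding \<Gamma>_X[abs_def] using X_M by simp
  have X_half: "(\<integral>\<^sup>+\<omega>. ennreal (exp (- X k \<omega>)) \<partial>M) = ennreal (1 / 2)" for k
    using distributed_nn_integral[OF X_exp, of "\<lambda>x. ennreal (exp (- x))" k]
    by (simp add: nn_integral_exp_neg_exponential[simplified])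
  have laplace: "(\<integral>\<^sup>+\<omega>. ennreal (exp (- \<Gamma> k \<omega>)) \<partial>M) = ennreal ((1 / 2) ^ Suc k)" for k
  proof -
    have "indep_vars (\<lambda>_. borel) (\<lambda>i \<omega>. ennreal (exp (- X i \<omega>))) {..k}"
      by (rule indep_vars_compose2[OF indep_vars_subset[OF X_indep]]) auto
    then have "(\<integral>\<^sup>+\<omega>. (\<Prod>i\<le>k. ennreal (exp (- X i \<omega>))) \<partial>M) = (\<Prod>i\<le>k. ennreal (1 / 2))"
      by (subst indep_vars_nn_integral) (auto simp: X_half)
    then show ?thesis
      by (simp add: \<Gamma>_X prod_ennreal exp_sum[symmetric] sum_negf ennreal_power ennreal_mult''[symmetric] del: ennreal_half)
  qed
  have "(\<integral>\<^sup>+\<omega>. (\<Sum>k. ennreal (exp (real (Suc k) / 2)) * ennreal (exp (- \<Gamma> k \<omega>))) \<partial>M) =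
      (\<Sum>k. ennreal ((exp (1 / 2) / 2) ^ Suc k))"
  proof (subst nn_integral_suminf)
    show "(\<Sum>k. \<integral>\<^sup>+\<omega>. ennreal (exp (real (Suc k) / 2)) * ennreal (exp (- \<Gamma> k \<omega>)) \<partial>M) =
        (\<Sum>k. ennreal ((exp (1 / 2) / 2) ^ Suc k))"
    proof (intro suminf_cong)
      fix k
      have "(\<integral>\<^sup>+\<omega>. ennreal (exp (real (Suc k) / 2)) * ennreal (exp (- \<Gamma> k \<omega>)) \<partial>M) =
          ennreal (exp (real (Suc k) / 2)) * ennreal ((1 / 2) ^ Suc k)"
        by (subst nn_integral_cmult) (simp_all add: laplace del: of_nat_Suc)
      also have "\<dots> = ennreal ((exp (1 / 2) / 2) ^ Suc k)"
      proof -
        have "exp (real (Suc k) / 2) = exp (1 / 2) ^ Suc k"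
          by (simp add: exp_of_nat_mult[symmetric] del: of_nat_Suc power_Suc)
        then show ?thesis
          by (subst ennreal_mult[symmetric]) (simp_all add: power_mult_distrib[symmetric] del: power_Suc)
      qed
      finally show "(\<integral>\<^sup>+\<omega>. ennreal (exp (real (Suc k) / 2)) * ennreal (exp (- \<Gamma> k \<omega>)) \<partial>M) =
          ennreal ((exp (1 / 2) / 2) ^ Suc k)" .
    qed
  qed simp
  also have "\<dots> < \<infinity>"
  proof -
    have "exp (1 / 2 :: real) * exp (1 / 2) < 2 * 2"
      using e_less_272 by (simp add: exp_add[symmetric])
    then have "exp (1 / 2 :: real) < 2"
      by (metis mult_mono' not_le zero_le_numeral)
    then have "summable (\<lambda>k. (exp (1 / 2 :: real) / 2) ^ Suc k)"
      by (subst summable_Suc_iff) (auto intro!: summable_geometric)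
    then show ?thesis
      by (subst suminf_ennreal2) auto
  qed
  finally have "AE \<omega> in M. (\<Sum>k. ennreal (exp (real (Suc k) / 2)) * ennreal (exp (- \<Gamma> k \<omega>))) \<noteq> \<infinity>"
    by (intro nn_integral_PInf_AE) auto
  then show ?thesis
  proof eventually_elim
    case (elim \<omega>)
    then obtain Q where Q: "0 \<le> Q" "(\<Sum>k. ennreal (exp (real (Suc k) / 2)) * ennreal (exp (- \<Gamma> k \<omega>))) = ennreal Q"
      by (cases "\<Sum>k. ennreal (exp (real (Suc k) / 2)) * ennreal (exp (- \<Gamma> k \<omega>))") auto
    have "real (Suc k) / 2 - ln (Q + 1) \<le> \<Gamma> k \<omega>" for k
    proof -
      have "ennreal (exp (real (Suc k) / 2)) * ennreal (exp (- \<Gamma> k \<omega>)) \<le> ennreal Q"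
        unfolding Q(2)[symmetric] by (rule ennreal_le_suminf)
      then have "exp (real (Suc k) / 2 - \<Gamma> k \<omega>) \<le> Q"
        using Q(1) by (simp add: ennreal_mult[symmetric] exp_add[symmetric])
      then have "exp (real (Suc k) / 2 - \<Gamma> k \<omega>) \<le> exp (ln (Q + 1))"
        using Q(1) by simp
      then show ?thesis by (simp only: exp_le_cancel_iff)
    qed
    then show ?case by blast
  qed
qed

text \<open>From \<open>k \<ge> 4 * C\<close> on, \<open>x k\<close> is at least a quarter of
  \<open>k + 1\<close>. The finitely many earlier values are absorbed into the constant, whatever
  their size or sign.\<close>

lemma inverse_power_le_of_linear_growth:
  fixes x :: "nat \<Rightarrow> real"
  assumes lin: "\<And>k. real (Suc k) / 2 - C \<le> x k" and p: "0 < p"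
  shows "\<exists>B. \<forall>k. x k powr -p \<le> B * real (Suc k) powr -p"
proof -
  define n where "n = nat \<lceil>4 * C\<rceil>"
  define B where "B = (\<Sum>k<n. x k powr -p * real (Suc k) powr p) + 4 powr p"
  have "x k powr -p \<le> B * real (Suc k) powr -p" for k
  proof -
    have "x k powr -p * real (Suc k) powr p \<le> B"
    proof (cases "k < n")
      case True
      then have "x k powr -p * real (Suc k) powr p \<le> (\<Sum>k<n. x k powr -p * real (Suc k) powr p)"
        by (intro member_le_sum) auto
      then show ?thesis by (simp add: B_def add_increasing2)
    next
      case False
      then have "4 * C \<le> real k" unfolding n_def by linarith
      then have "real (Suc k) / 4 \<le> x k" using lin[of k] by (simp add: field_simps)
      then have "x k powr -p \<le> (real (Suc k) / 4) powr -p"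
        using p by (intro powr_mono2') auto
      then have "x k powr -p * real (Suc k) powr p \<le> (real (Suc k) / 4) powr -p * real (Suc k) powr p"
        by (rule mult_right_mono) simp
      also have "\<dots> = 4 powr p"
        by (simp add: powr_divide powr_minus field_simps del: of_nat_Suc)
      also have "\<dots> \<le> B" by (simp add: B_def sum_nonneg)
      finally show ?thesis .
    qed
    then show ?thesis by (simp add: powr_minus field_simps)
  qed
  then show ?thesis by blast
qed

text \<open>Cover by dyadic balls: the \<open>j\<close>-th ball carries height
  \<open>2 ^ Suc j / R\<close> and, in the plane, area proportional to
  \<open>(R / 2 ^ j)\<^sup>2\<close>, so the contributions decay like \<open>(1/2) ^ j\<close>. At
  \<open>y = x\<close> the integrand is 0 by the convention for division by zero.\<close>

lemma nn_integral_inverse_dist_ball: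
  fixes x :: "real^2"
  assumes R: "0 < R"
  shows "(\<integral>\<^sup>+y. indicator (ball x R) y * ennreal (1 / dist x y) \<partial>lborel) < \<infinity>"
proof -
  have le: "indicator (ball x R) y * ennreal (1 / dist x y) \<le>
      (\<Sum>j. ennreal (2 ^ Suc j / R) * indicator (ball x (R / 2 ^ j)) y)" for y
  proof (cases "y \<in> ball x R \<and> y \<noteq> x")
    case False
    then show ?thesis by (auto split: split_indicator)
  next
    case True
    define r where "r = dist x y"
    have r: "0 < r" "r < R" using True by (auto simp: r_def)
    have "\<exists>n. (1 / 2) ^ n < r / R" using r R by (intro real_arch_pow_inv) auto
    then have ex: "\<exists>n. R / 2 ^ n < r" using R by (simp add: power_one_over field_simps)
    define n where "n = (LEAST n. R / 2 ^ n < r)"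
    have n: "R / 2 ^ n < r" unfolding n_def by (rule LeastI_ex[OF ex])
    then have "n \<noteq> 0" using r by (intro notI) simp
    then obtain j where j: "n = Suc j" by (cases n) auto
    have "\<not> R / 2 ^ j < r" using not_less_Least[of j "\<lambda>n. R / 2 ^ n < r"] j
      by (simp add: n_def)
    show ?thesis
    proof (cases "r = R / 2 ^ j")
      \<comment> \<open>On the boundary circle the open ball of index \<open>j\<close> misses
        \<open>y\<close>; the next larger one, of index \<open>j - 1\<close>, has exactly the
        required height \<open>1 / r\<close>.\<close>
      case eq: True
      then have "j \<noteq> 0" using r by (intro notI) simp
      then obtain i where i: "j = Suc i" by (cases j) auto
      have "indicator (ball x R) y * ennreal (1 / dist x y) \<le> ennreal (2 ^ Suc i / R) * indicator (ball x (R / 2 ^ i)) y"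
        using eq r R i True by (simp add: r_def[symmetric] field_simps)
      also have "\<dots> \<le> (\<Sum>j. ennreal (2 ^ Suc j / R) * indicator (ball x (R / 2 ^ j)) y)"
        by (rule ennreal_le_suminf)
      finally show ?thesis .
    next
      case False
      then have "r < R / 2 ^ j" using \<open>\<not> R / 2 ^ j < r\<close> by simp
      moreover have "1 / r \<le> 2 ^ Suc j / R" using n r R j by (simp add: field_simps)
      ultimately have "indicator (ball x R) y * ennreal (1 / dist x y) \<le> ennreal (2 ^ Suc j / R) * indicator (ball x (R / 2 ^ j)) y"
        using True by (simp add: r_def[symmetric] ennreal_leI)
      also have "\<dots> \<le> (\<Sum>j. ennreal (2 ^ Suc j / R) * indicator (ball x (R / 2 ^ j)) y)"
        by (rule ennreal_le_suminf)
      finally show ?thesis .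
    qed
  qed
  have "(\<integral>\<^sup>+y. indicator (ball x R) y * ennreal (1 / dist x y) \<partial>lborel) \<le>
      (\<integral>\<^sup>+y. (\<Sum>j. ennreal (2 ^ Suc j / R) * indicator (ball x (R / 2 ^ j)) y) \<partial>lborel)"
    by (intro nn_integral_mono le)
  also have "\<dots> = (\<Sum>j. ennreal (2 ^ Suc j / R) * emeasure lborel (ball x (R / 2 ^ j)))"
    by (subst nn_integral_suminf)
       (auto simp del: power_Suc simp: nn_integral_cmult_indicator
         intro!: borel_measurable_times_ennreal borel_measurable_indicator)
  also have "\<dots> = (\<Sum>j. ennreal (2 * R * unit_ball_vol 2 * (1 / 2) ^ j))"
  proof (intro suminf_cong)
    fix j
    have "ennreal (2 ^ Suc j / R) * emeasure lborel (ball x (R / 2 ^ j)) =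
        ennreal (2 ^ Suc j / R * (unit_ball_vol 2 * (R / 2 ^ j)\<^sup>2))"
      using R by (simp add: emeasure_ball ennreal_mult[symmetric] del: power_Suc)
    also have "2 ^ Suc j / R * (unit_ball_vol 2 * (R / 2 ^ j)\<^sup>2) = 2 * R * unit_ball_vol 2 * (1 / 2) ^ j"
      using R by (simp add: power2_eq_square power_one_over field_simps)
    finally show "ennreal (2 ^ Suc j / R) * emeasure lborel (ball x (R / 2 ^ j)) =
        ennreal (2 * R * unit_ball_vol 2 * (1 / 2) ^ j)" .
  qed
  also have "\<dots> < \<infinity>"
    using R by (subst suminf_ennreal2) (auto intro!: mult_nonneg_nonneg summable_mult summable_geometric)
  finally show ?thesis .
qed

lemma (in prob_space) AE_summable_of_bounded_expectation:
  fixes Y :: "nat \<Rightarrow> 'a \<Rightarrow> real"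
  assumes Y: "\<And>k. Y k \<in> borel_measurable M" and Y_nonneg: "\<And>k \<omega>. 0 \<le> Y k \<omega>"
    and E: "\<And>k. (\<integral>\<^sup>+\<omega>. ennreal (Y k \<omega>) \<partial>M) \<le> ennreal e"
    and w: "summable w" and w_nonneg: "\<And>k. 0 \<le> w k"
  shows "AE \<omega> in M. summable (\<lambda>k. w k * Y k \<omega>)"
proof -
  note Y[measurable]
  define e' where "e' = max 0 e"
  have "(\<integral>\<^sup>+\<omega>. (\<Sum>k. ennreal (w k * Y k \<omega>)) \<partial>M) = (\<Sum>k. ennreal (w k) * (\<integral>\<^sup>+\<omega>. ennreal (Y k \<omega>) \<partial>M))"
    by (simp add: nn_integral_suminf nn_integral_cmult ennreal_mult w_nonneg Y_nonneg)
  also have "\<dots> \<le> (\<Sum>k. ennreal (w k) * ennreal e')"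
    using E by (intro suminf_le mult_left_mono order_trans[OF E]) (auto simp: e'_def intro: ennreal_leI)
  also have "\<dots> = (\<Sum>k. ennreal (w k * e'))"
    by (simp add: ennreal_mult w_nonneg e'_def)
  also have "\<dots> < \<infinity>"
    using w w_nonneg by (subst suminf_ennreal2) (auto simp: e'_def intro!: summable_mult2)
  finally have "AE \<omega> in M. (\<Sum>k. ennreal (w k * Y k \<omega>)) \<noteq> \<infinity>"
    by (intro nn_integral_PInf_AE) auto
  then show ?thesis
  proof eventually_elim
    case (elim \<omega>)
    then show ?case
      using w_nonneg Y_nonneg by (intro summable_suminf_not_top) auto
  qed
qed

text \<open>Under the law of \<xi> the squared weight is multiplied by the density. The product of
  all powers of \<phi> is continuous, hence bounded on the compact ball, and the remaining factor
  \<open>1 / dist x y\<close> is integrable there.\<close>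

lemma (in prob_space) nn_integral_singular_weight_finite:
  fixes x :: "real^2" and \<xi> :: "'a \<Rightarrow> real^2"
  assumes \<phi>_cont: "continuous_on UNIV \<phi>" and \<phi>_pos: "\<And>y. 0 < \<phi> y"
    and \<xi>: "distributed M lborel \<xi> (\<lambda>y. ennreal (\<phi> y))" and R: "0 < R"
  shows "(\<integral>\<^sup>+\<omega>. ennreal ((\<phi> (\<xi> \<omega>) powr -p * (indicator (ball x R) (\<xi> \<omega>) / sqrt (dist x (\<xi> \<omega>))))\<^sup>2) \<partial>M) < \<infinity>"
proof -
  have [measurable]: "\<phi> \<in> borel_measurable borel"
    by (rule borel_measurable_continuous_onI[OF \<phi>_cont])
  have [measurable]: "indicator (ball x R) \<in> borel_measurable (borel :: (real^2) measure)" for R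
    by (intro borel_measurable_indicator) auto
  define \<psi> where "\<psi> y = \<phi> y * (\<phi> y powr -p)\<^sup>2" for y
  have "continuous_on (cball x R) \<psi>"
    unfolding \<psi>_def using \<phi>_pos
    by (intro continuous_intros continuous_on_subset[OF \<phi>_cont]) (auto simp: less_imp_neq[THEN not_sym])
  then have "compact (\<psi> ` cball x R)" by (intro compact_continuous_image) auto
  then obtain m where m: "\<And>y. y \<in> cball x R \<Longrightarrow> norm (\<psi> y) \<le> m"
    using compact_imp_bounded bounded_iff by (metis imageI)
  have "0 \<le> m" using m[of x] R by (smt (verit) centre_in_cball norm_ge_zero)
  have "(\<integral>\<^sup>+\<omega>. ennreal ((\<phi> (\<xi> \<omega>) powr -p * (indicator (ball x R) (\<xi> \<omega>) / sqrt (dist x (\<xi> \<omega>))))\<^sup>2) \<partial>M) =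
      (\<integral>\<^sup>+y. ennreal (\<phi> y) * ennreal ((\<phi> y powr -p * (indicator (ball x R) y / sqrt (dist x y)))\<^sup>2) \<partial>lborel)"
    by (rule distributed_nn_integral[OF \<xi>, symmetric]) simp
  also have "\<dots> \<le> (\<integral>\<^sup>+y. ennreal m * (indicator (ball x R) y * ennreal (1 / dist x y)) \<partial>lborel)"
  proof (rule nn_integral_mono)
    fix y
    show "ennreal (\<phi> y) * ennreal ((\<phi> y powr -p * (indicator (ball x R) y / sqrt (dist x y)))\<^sup>2) \<le>
        ennreal m * (indicator (ball x R) y * ennreal (1 / dist x y))"
    proof (cases "y \<in> ball x R")
      case True
      have "\<phi> y * (\<phi> y powr -p * (1 / sqrt (dist x y)))\<^sup>2 = \<psi> y * (1 / dist x y)"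
        by (simp add: \<psi>_def power_mult_distrib power_divide)
      also have "\<dots> \<le> m * (1 / dist x y)"
        using m[of y] True by (intro mult_right_mono) auto
      finally show ?thesis
        using True \<open>0 \<le> m\<close> \<phi>_pos[of y] by (simp add: ennreal_mult'[symmetric] ennreal_leI)
    qed simp
  qed
  also have "\<dots> = ennreal m * (\<integral>\<^sup>+y. indicator (ball x R) y * ennreal (1 / dist x y) \<partial>lborel)"
    by (rule nn_integral_cmult) measurable
  also have "\<dots> < \<infinity>"
    using nn_integral_inverse_dist_ball[OF R, of x] by (simp add: ennreal_mult_less_top)
  finally show ?thesis .
qed

section \<open>The LePage series\<close>

lemma Int_stable_seq_sigma: "Int_stable (seq_sigma M X)"
proof -
  interpret sigma_algebra "space M" "seq_sigma M X"
    unfolding seq_sigma_def by (rule sigma_algebra_sigma_sets) auto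
  show ?thesis by (auto simp: Int_stable_def)
qed

lemma measurable_seq_sigma:
  assumes "seq_sigma M X \<subseteq> sets N" "space N = space M"
  shows "X k \<in> borel_measurable N"
proof (rule measurableI)
  fix A :: "'b set" assume "A \<in> sets borel"
  then have "X k -` A \<inter> space M \<in> seq_sigma M X"
    unfolding seq_sigma_def by (intro sigma_sets.Basic) blast
  then show "X k -` A \<inter> space N \<in> sets N" using assms by auto
qed simp

text \<open>Groups the arrival times and positions against the Gaussian variables. Independence
  passes from intersection-stable families to the sigma-algebras generated by disjoint blocks of
  them.\<close>

lemma (in prob_space) lepage_families_indep:
  assumes indep: "indep_sets
      (\<lambda>i. case i of FamGamma \<Rightarrow> seq_sigma M X | FamXi \<Rightarrow> seq_sigma M Y | FamG \<Rightarrow> seq_sigma M Z) UNIV"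
  obtains F H where "subalgebra M F" "subalgebra M H" "indep_set (sets F) (sets H)"
    "\<And>k. X k \<in> borel_measurable F" "\<And>k. Y k \<in> borel_measurable F" "\<And>k. Z k \<in> borel_measurable H"
proof -
  let ?E = "\<lambda>i. case i of FamGamma \<Rightarrow> seq_sigma M X | FamXi \<Rightarrow> seq_sigma M Y | FamG \<Rightarrow> seq_sigma M Z"
  have events: "seq_sigma M X \<subseteq> events" "seq_sigma M Y \<subseteq> events" "seq_sigma M Z \<subseteq> events"
    using indep unfolding indep_sets_def
    by (metis UNIV_I lepage_family.simps(7), metis UNIV_I lepage_family.simps(8), metis UNIV_I lepage_family.simps(9))
  have sub: "seq_sigma M X \<union> seq_sigma M Y \<subseteq> Pow (space M)" "seq_sigma M Z \<subseteq> Pow (space M)"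
    using events sets.space_closed by blast+
  define F where "F = sigma (space M) (seq_sigma M X \<union> seq_sigma M Y)"
  define H where "H = sigma (space M) (seq_sigma M Z)"
  have sets_F: "sets F = sigma_sets (space M) (seq_sigma M X \<union> seq_sigma M Y)" and [simp]: "space F = space M"
    using sub by (simp_all add: F_def)
  have sets_H: "sets H = sigma_sets (space M) (seq_sigma M Z)" and [simp]: "space H = space M"
    using sub by (simp_all add: H_def)
  \<comment> \<open>The blocks are indexed by truth values to match \<open>indep_set\<close>, which
    is independence of a family of the form \<open>case_bool\<close>.\<close>
  define I where "I b = (if b then {FamGamma, FamXi} else {FamG})" for b
  have "indep_sets (\<lambda>b. sigma_sets (space M) (\<Union>i\<in>I b. ?E i)) UNIV"
  proof (rule indep_sets_collect_sigma)
    have "(\<Union>b. I b) = UNIV"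
      using lepage_family.exhaust by (auto simp: I_def UNIV_bool)
    then show "indep_sets ?E (\<Union>b\<in>UNIV. I b)" using indep by simp
    show "disjoint_family_on I UNIV" by (auto simp: disjoint_family_on_def I_def)
    show "Int_stable (?E i)" for i
      by (cases i) (simp_all add: Int_stable_seq_sigma)
  qed
  moreover have "(\<lambda>b. sigma_sets (space M) (\<Union>i\<in>I b. ?E i)) = case_bool (sets F) (sets H)"
    by (auto simp: fun_eq_iff I_def sets_F sets_H split: bool.split)
  ultimately have "indep_set (sets F) (sets H)" by (simp add: indep_set_def)
  moreover have "subalgebra M F" "subalgebra M H"
    using events sets.sigma_sets_subset[of "seq_sigma M X \<union> seq_sigma M Y" M] sets.sigma_sets_subset[of "seq_sigma M Z" M]
    by (auto simp: subalgebra_def sets_F sets_H)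
  moreover have "X k \<in> borel_measurable F" "Y k \<in> borel_measurable F" "Z k \<in> borel_measurable H" for k
    by (rule measurable_seq_sigma, auto simp: sets_F sets_H)+
  ultimately show thesis using that by blast
qed

theorem theorem4:
  fixes M :: "'w measure"
    and \<alpha> a \<gamma> T s :: real
    and \<sigma> :: "real^2 \<Rightarrow> real \<Rightarrow> real"
    and \<phi> :: "real^2 \<Rightarrow> real"
    and \<Gamma>\<^sub>k :: "nat \<Rightarrow> 'w \<Rightarrow> real"
    and \<xi> :: "nat \<Rightarrow> 'w \<Rightarrow> real^2"
    and g :: "nat \<Rightarrow> 'w \<Rightarrow> real"
    and x :: "real^2"
  assumes "prob_space M"
    and \<alpha>: "0 < \<alpha>" "\<alpha> < 2"
    and a: "0 < a"
    and \<sigma>_cont: "continuous_on (UNIV \<times> {0..}) (\<lambda>(y, t). \<sigma> y t)"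
    and \<sigma>_bdd: "\<exists>B. \<forall>y. \<forall>t\<ge>0. \<bar>\<sigma> y t\<bar> \<le> B"
    and \<gamma>: "0 < \<gamma>" "\<gamma> \<le> 1"
    and \<sigma>_hoelder: "\<And>y t u. 0 \<le> t \<Longrightarrow> 0 \<le> u \<Longrightarrow> \<bar>\<sigma> y t - \<sigma> y u\<bar> \<le> \<bar>t - u\<bar> powr \<gamma>"
    and \<phi>_cont: "continuous_on UNIV \<phi>"
    and \<phi>_pos: "\<And>y. 0 < \<phi> y"
    and \<phi>_dens: "(\<integral>\<^sup>+ y. ennreal (\<phi> y) \<partial>lborel) = 1"
    \<comment> \<open>Poisson arrival times: the interarrival times are i.i.d. Exp(1)\<close>
    and \<Gamma>_incr_indep: "prob_space.indep_vars M (\<lambda>_. borel)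
          (\<lambda>k \<omega>. \<Gamma>\<^sub>k k \<omega> - (if k = 0 then 0 else \<Gamma>\<^sub>k (k - 1) \<omega>)) UNIV"
    and \<Gamma>_incr_exp: "\<And>k. distributed M lborel
          (\<lambda>\<omega>. \<Gamma>\<^sub>k k \<omega> - (if k = 0 then 0 else \<Gamma>\<^sub>k (k - 1) \<omega>))
          (\<lambda>r. ennreal (exponential_density 1 r))"
    \<comment> \<open>xi_k i.i.d. with density phi\<close>
    and \<xi>_indep: "prob_space.indep_vars M (\<lambda>_. borel) \<xi> UNIV"
    and \<xi>_dens: "\<And>k. distributed M lborel (\<xi> k) (\<lambda>y. ennreal (\<phi> y))"
    \<comment> \<open>g_k i.i.d. centered Gaussian with E|g_k|^alpha = 1\<close>
    and s: "0 < s"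
    and g_indep: "prob_space.indep_vars M (\<lambda>_. borel) g UNIV"
    and g_gauss: "\<And>k. distributed M lborel (g k) (\<lambda>r. ennreal (normal_density 0 s r))"
    and g_moment: "\<And>k. (\<integral>\<omega>. \<bar>g k \<omega>\<bar> powr \<alpha> \<partial>M) = 1"
    \<comment> \<open>the three families are mutually independent\<close>
    and fam_indep: "prob_space.indep_sets M
          (\<lambda>i. case i of FamGamma \<Rightarrow> seq_sigma M \<Gamma>\<^sub>k | FamXi \<Rightarrow> seq_sigma M \<xi> | FamG \<Rightarrow> seq_sigma M g)
          UNIV"
    and T: "0 < T"
  shows "AE \<omega> in M.
           (\<forall>t\<in>{0..T}. summable (lepage_term \<alpha> a \<sigma> \<phi> \<Gamma>\<^sub>k \<xi> g x t \<omega>)) \<and>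
           (\<forall>\<beta>. 0 < \<beta> \<and> \<beta> < min \<gamma> (1 / 2) \<longrightarrow>
              (\<exists>C. \<forall>t\<in>{0..T}. \<forall>u\<in>{0..T}.
                 \<bar>lepage_U \<alpha> a \<sigma> \<phi> \<Gamma>\<^sub>k \<xi> g x t \<omega> - lepage_U \<alpha> a \<sigma> \<phi> \<Gamma>\<^sub>k \<xi> g x u \<omega>\<bar>
                   \<le> C * \<bar>t - u\<bar> powr \<beta>))"
proof -
  interpret prob_space M by fact
  define \<eta> where "\<eta> = min \<gamma> (1 / 2)"
  have \<eta>: "0 < \<eta>" using \<gamma> by (simp add: \<eta>_def)
  obtain F H where F: "subalgebra M F" and H: "subalgebra M H" and FH: "indep_set (sets F) (sets H)"
    and \<Gamma>_F [measurable]: "\<And>k. \<Gamma>\<^sub>k k \<in> borel_measurable F"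
    and \<xi>_F [measurable]: "\<And>k. \<xi> k \<in> borel_measurable F"
    and g_H: "\<And>k. g k \<in> borel_measurable H"
    using lepage_families_indep[OF fam_indep] by blast
  have \<xi>_M [measurable]: "\<xi> k \<in> borel_measurable M" for k
    by (rule measurable_from_subalg[OF F \<xi>_F])
  have [measurable]: "\<phi> \<in> borel_measurable borel"
    by (rule borel_measurable_continuous_onI[OF \<phi>_cont])
  have G_meas [measurable]: "(\<lambda>y. Gker a \<sigma> x y t) \<in> borel_measurable borel" for t
    by (rule Gker_measurable[OF \<sigma>_cont])
  have [measurable]: "indicator (ball x R) \<in> borel_measurable (borel :: (real^2) measure)" for R
    by (intro borel_measurable_indicator) auto
  obtain B where B: "\<And>y t. 0 \<le> t \<Longrightarrow> \<bar>\<sigma> y t\<bar> \<le> B" using \<sigma>_bdd by blast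
  have \<sigma>y_cont: "continuous_on {0..} (\<sigma> y)" for y
  proof -
    have "continuous_on {0..} (\<lambda>t. (\<lambda>(y, t). \<sigma> y t) (y, t))"
      by (intro continuous_on_compose2[OF \<sigma>_cont] continuous_intros) auto
    then show ?thesis by simp
  qed
  obtain K where K: "0 \<le> K"
    and G_hoelder: "\<forall>y t u. y \<noteq> x \<longrightarrow> t \<in> {0..T} \<longrightarrow> u \<in> {0..T} \<longrightarrow>
      \<bar>Gker a \<sigma> x y t - Gker a \<sigma> x y u\<bar> \<le>
        K * indicator (ball x (a * T)) y / sqrt (dist x y) * \<bar>t - u\<bar> powr \<eta>"
    using Gker_hoelder_uniform[of a \<sigma>, OF a \<sigma>y_cont B \<sigma>_hoelder T, of x] unfolding \<eta>_def by auto
  define c where "c k t \<omega> = C_alpha \<alpha> * \<Gamma>\<^sub>k k \<omega> powr (-1 / \<alpha>) * \<phi> (\<xi> k \<omega>) powr (-1 / \<alpha>) *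
    Gker a \<sigma> x (\<xi> k \<omega>) t" for k t \<omega>
  \<comment> \<open>\<open>Y\<close> collects the part of the Hoelder constant that depends on the
    position alone. It is handled in mean square, whereas the power of the arrival time in
    \<open>L\<close> is bounded pathwise.\<close>
  define Y where "Y k \<omega> = \<phi> (\<xi> k \<omega>) powr (-1 / \<alpha>) *
    (indicator (ball x (a * T)) (\<xi> k \<omega>) / sqrt (dist x (\<xi> k \<omega>)))" for k \<omega>
  define L where "L k \<omega> = \<bar>C_alpha \<alpha>\<bar> * K * \<Gamma>\<^sub>k k \<omega> powr (-1 / \<alpha>) * Y k \<omega>" for k \<omega>
  have c_F: "c k t \<in> borel_measurable F" for k t
    unfolding c_def[abs_def] by measurable
  have Y_F [measurable]: "Y k \<in> borel_measurable F" for k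
    unfolding Y_def[abs_def] by measurable
  have L_F: "L k \<in> borel_measurable F" for k
    unfolding L_def[abs_def] by measurable
  have Y_M [measurable]: "Y k \<in> borel_measurable M" for k
    by (rule measurable_from_subalg[OF F Y_F])
  have c_0: "c k 0 \<omega> = 0" for k \<omega>
    by (simp add: c_def Gker_def)
  \<comment> \<open>The kernel estimate excludes the singular point, which the positions almost
    surely avoid because they have a density.\<close>
  have "AE \<omega> in M. \<forall>k. \<xi> k \<omega> \<noteq> x"
    unfolding AE_all_countable
  proof
    fix k
    show "AE \<omega> in M. \<xi> k \<omega> \<noteq> x"
      using AE_lborel_singleton[of x] by (subst distributed_AE2[OF \<xi>_dens]) auto
  qed
  then have c_hoelder: "AE \<omega> in M. \<forall>k. \<forall>t\<in>{0..T}. \<forall>u\<in>{0..T}.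
      \<bar>c k t \<omega> - c k u \<omega>\<bar> \<le> L k \<omega> * \<bar>t - u\<bar> powr \<eta>"
  proof eventually_elim
    case (elim \<omega>)
    show ?case
    proof (intro allI ballI)
      fix k t u assume tu: "t \<in> {0..T}" "u \<in> {0..T}"
      define e where "e = C_alpha \<alpha> * \<Gamma>\<^sub>k k \<omega> powr (-1 / \<alpha>) * \<phi> (\<xi> k \<omega>) powr (-1 / \<alpha>)"
      have "\<bar>c k t \<omega> - c k u \<omega>\<bar> = \<bar>e\<bar> * \<bar>Gker a \<sigma> x (\<xi> k \<omega>) t - Gker a \<sigma> x (\<xi> k \<omega>) u\<bar>"
        unfolding c_def e_def[symmetric] by (simp add: abs_mult right_diff_distrib[symmetric])
      also have "\<dots> \<le> \<bar>e\<bar> * (K * indicator (ball x (a * T)) (\<xi> k \<omega>) / sqrt (dist x (\<xi> k \<omega>)) * \<bar>t - u\<bar> powr \<eta>)"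
        using elim tu by (intro mult_left_mono G_hoelder[rule_format]) auto
      also have "\<dots> = L k \<omega> * \<bar>t - u\<bar> powr \<eta>"
        by (simp add: L_def Y_def e_def abs_mult)
      finally show "\<bar>c k t \<omega> - c k u \<omega>\<bar> \<le> L k \<omega> * \<bar>t - u\<bar> powr \<eta>" .
    qed
  qed
  \<comment> \<open>Here \<open>\<alpha> < 2\<close> is decisive: \<open>2 / \<alpha>\<close>
    exceeds 1, and a quarter of the excess, capped at 1, leaves room for the weight.\<close>
  obtain \<delta> where \<delta>: "0 < \<delta>" "\<delta> \<le> 2" "2 * \<delta> - 2 / \<alpha> < -1"
  proof -
    have "0 < min 1 ((p - 1) / 4) \<and> min 1 ((p - 1) / 4) \<le> 2 \<and> 2 * min 1 ((p - 1) / 4) - p < -1"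
      if "1 < p" for p :: real
      using that by (auto simp: min_def field_simps)
    moreover have "1 < 2 / \<alpha>" using \<alpha> by simp
    ultimately show ?thesis using that by blast
  qed
  have Y_E: "\<exists>e. \<forall>k. (\<integral>\<^sup>+\<omega>. ennreal ((Y k \<omega>)\<^sup>2) \<partial>M) \<le> ennreal e"
  proof -
    \<comment> \<open>The right-hand side does not depend on \<open>k\<close>, so a bound for index
      0 serves all indices.\<close>
    have E: "(\<integral>\<^sup>+\<omega>. ennreal ((Y k \<omega>)\<^sup>2) \<partial>M) = (\<integral>\<^sup>+y. ennreal (\<phi> y) * ennreal ((\<phi> y powr (-1 / \<alpha>) *
      (indicator (ball x (a * T)) y / sqrt (dist x y)))\<^sup>2) \<partial>lborel)" for k
      unfolding Y_def by (rule distributed_nn_integral[OF \<xi>_dens, symmetric]) simp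
    have "(\<integral>\<^sup>+\<omega>. ennreal ((Y 0 \<omega>)\<^sup>2) \<partial>M) < \<infinity>"
      using nn_integral_singular_weight_finite[OF \<phi>_cont \<phi>_pos \<xi>_dens[of 0], of "a * T" "1 / \<alpha>" x] a T
      by (simp add: Y_def)
    then obtain e where "(\<integral>\<^sup>+\<omega>. ennreal ((Y 0 \<omega>)\<^sup>2) \<partial>M) = ennreal e"
      by (cases "\<integral>\<^sup>+\<omega>. ennreal ((Y 0 \<omega>)\<^sup>2) \<partial>M") auto
    then have "(\<integral>\<^sup>+\<omega>. ennreal ((Y k \<omega>)\<^sup>2) \<partial>M) \<le> ennreal e" for k
      unfolding E by simp
    then show ?thesis by blast
  qed
  then obtain e where e: "\<And>k. (\<integral>\<^sup>+\<omega>. ennreal ((Y k \<omega>)\<^sup>2) \<partial>M) \<le> ennreal e" by blast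
  have "summable (\<lambda>k. real k powr (2 * \<delta> - 2 / \<alpha>))"
    using \<delta>(3) by (simp add: summable_real_powr_iff)
  then have "summable (\<lambda>k. real (Suc k) powr (2 * \<delta> - 2 / \<alpha>))"
    by (subst summable_Suc_iff)
  then have Y_sum: "AE \<omega> in M. summable (\<lambda>k. real (Suc k) powr (2 * \<delta> - 2 / \<alpha>) * (Y k \<omega>)\<^sup>2)"
    by (intro AE_summable_of_bounded_expectation[OF _ _ e]) auto
  \<comment> \<open>Pathwise linear growth replaces the squared power of the arrival time by a
    random constant times \<open>(k+1) powr (-2/\<alpha>)\<close>, leaving the deterministic weights
    of \<open>Y_sum\<close>.\<close>
  have L_sum: "AE \<omega> in M. summable (\<lambda>k. real (Suc k) powr (2 * \<delta>) * (L k \<omega>)\<^sup>2)"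
    using Y_sum poisson_arrivals_grow_linearly[OF \<Gamma>_incr_indep \<Gamma>_incr_exp]
  proof eventually_elim
    case (elim \<omega>)
    then obtain D where "\<And>k. \<Gamma>\<^sub>k k \<omega> powr -(1 / \<alpha>) \<le> D * real (Suc k) powr -(1 / \<alpha>)"
      using inverse_power_le_of_linear_growth[of _ "\<lambda>k. \<Gamma>\<^sub>k k \<omega>" "1 / \<alpha>"] \<alpha> by (metis divide_pos_pos zero_less_one)
    then have D: "\<Gamma>\<^sub>k k \<omega> powr (-1 / \<alpha>) \<le> D * real (Suc k) powr (-1 / \<alpha>)" for k
      by simp
    show ?case
    proof (rule summable_comparison_test')
      show "summable (\<lambda>k. (\<bar>C_alpha \<alpha>\<bar> * K * D)\<^sup>2 * (real (Suc k) powr (2 * \<delta> - 2 / \<alpha>) * (Y k \<omega>)\<^sup>2))"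
        using elim(1) by (rule summable_mult)
      fix k
      have "(\<Gamma>\<^sub>k k \<omega> powr (-1 / \<alpha>))\<^sup>2 \<le> (D * real (Suc k) powr (-1 / \<alpha>))\<^sup>2"
        by (rule power_mono[OF D]) simp
      then have "(real (Suc k) powr (2 * \<delta>) * (\<bar>C_alpha \<alpha>\<bar> * K * Y k \<omega>)\<^sup>2) * (\<Gamma>\<^sub>k k \<omega> powr (-1 / \<alpha>))\<^sup>2 \<le>
          (real (Suc k) powr (2 * \<delta>) * (\<bar>C_alpha \<alpha>\<bar> * K * Y k \<omega>)\<^sup>2) * (D * real (Suc k) powr (-1 / \<alpha>))\<^sup>2"
        by (rule mult_left_mono) simp
      moreover have "real (Suc k) powr (2 * \<delta>) * (real (Suc k) powr (-1 / \<alpha>))\<^sup>2 = real (Suc k) powr (2 * \<delta> - 2 / \<alpha>)"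
        by (simp add: power2_eq_square powr_add[symmetric] del: of_nat_Suc)
      ultimately show "norm (real (Suc k) powr (2 * \<delta>) * (L k \<omega>)\<^sup>2) \<le>
          (\<bar>C_alpha \<alpha>\<bar> * K * D)\<^sup>2 * (real (Suc k) powr (2 * \<delta> - 2 / \<alpha>) * (Y k \<omega>)\<^sup>2)"
        by (simp add: L_def power_mult_distrib ac_simps del: of_nat_Suc)
    qed
  qed
  \<comment> \<open>Countably many exponents tending to \<open>\<eta>\<close>, so that one null set
    serves every \<open>\<beta> < \<eta>\<close>. The shift by 2 keeps them positive.\<close>
  define \<beta>' where "\<beta>' m = \<eta> * (1 - 1 / (real m + 2))" for m
  have \<beta>': "0 < \<beta>' m" "\<beta>' m < \<eta>" for m
    using \<eta> by (auto simp: \<beta>'_def field_simps add_pos_nonneg)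
  have term_eq: "lepage_term \<alpha> a \<sigma> \<phi> \<Gamma>\<^sub>k \<xi> g x t \<omega> = (\<lambda>k. c k t \<omega> * g k \<omega>)" for t \<omega>
    by (simp add: fun_eq_iff lepage_term_def c_def)
  have "AE \<omega> in M. \<forall>m. (\<forall>t\<in>{0..T}. summable (\<lambda>k. c k t \<omega> * g k \<omega>)) \<and>
    (\<exists>C. \<forall>t\<in>{0..T}. \<forall>u\<in>{0..T}.
      \<bar>(\<Sum>k. c k t \<omega> * g k \<omega>) - (\<Sum>k. c k u \<omega> * g k \<omega>)\<bar> \<le> C * \<bar>t - u\<bar> powr \<beta>' m)"
    unfolding AE_all_countable
    using gaussian_series_hoelder[OF F H FH g_H c_F L_F s g_indep g_gauss T \<delta>(1,2) \<beta>' c_0 c_hoelder L_sum]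
    by blast
  then show ?thesis
  proof eventually_elim
    case (elim \<omega>)
    have "\<exists>C. \<forall>t\<in>{0..T}. \<forall>u\<in>{0..T}.
        \<bar>(\<Sum>k. c k t \<omega> * g k \<omega>) - (\<Sum>k. c k u \<omega> * g k \<omega>)\<bar> \<le> C * \<bar>t - u\<bar> powr \<beta>"
      if \<beta>: "0 < \<beta>" "\<beta> < \<eta>" for \<beta>
    proof -
      \<comment> \<open>This makes \<open>\<eta> / (m + 2)\<close> at most
        \<open>\<eta> - \<beta>\<close>, hence \<open>\<beta> \<le> \<beta>' m\<close>; the exponent
        is then lowered to \<open>\<beta>\<close> at the cost of a power of
        \<open>T\<close>.\<close>
      obtain m :: nat where "\<eta> / (\<eta> - \<beta>) < real m" using reals_Archimedean2 by blast
      then have "\<eta> < (\<eta> - \<beta>) * (real m + 2)"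
        using \<beta> by (simp add: pos_divide_less_eq algebra_simps)
      then have m: "\<beta> \<le> \<beta>' m" by (simp add: \<beta>'_def field_simps)
      obtain C where C: "\<And>t u. t \<in> {0..T} \<Longrightarrow> u \<in> {0..T} \<Longrightarrow>
          \<bar>(\<Sum>k. c k t \<omega> * g k \<omega>) - (\<Sum>k. c k u \<omega> * g k \<omega>)\<bar> \<le> C * \<bar>t - u\<bar> powr \<beta>' m"
        using elim by blast
      have "\<bar>(\<Sum>k. c k t \<omega> * g k \<omega>) - (\<Sum>k. c k u \<omega> * g k \<omega>)\<bar> \<le> (\<bar>C\<bar> * T powr (\<beta>' m - \<beta>)) * \<bar>t - u\<bar> powr \<beta>"
        if tu: "t \<in> {0..T}" "u \<in> {0..T}" for t u
      proof -
        have "C * \<bar>t - u\<bar> powr \<beta>' m \<le> \<bar>C\<bar> * (T powr (\<beta>' m - \<beta>) * \<bar>t - u\<bar> powr \<beta>)"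
          using tu m by (intro mult_mono powr_le_powr_smaller_exponent) auto
        then show ?thesis using C[OF tu] by (simp add: mult.assoc)
      qed
      then show ?thesis by blast
    qed
    then show ?case
      using elim unfolding lepage_U_def term_eq \<eta>_def by blast
  qed
qed

end
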